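(* Let $(\mathcal{M}, g, A)$ be a K\"ahler manifold of dimension $n$ with a quarter-symmetric metric $A$-connection $\overset{1}{\nabla}_XY=\overset{g}{\nabla}_XY-\pi(X)AY$ with generator $\pi$. Let $\overset{g}{P}$ be the holomorphically projective curvature tensor and let $\overset{0}{H},\overset{1}{H},\overset{2}{H},\overset{4}{H},\overset{5}{H}$ be the tensors defined in the context. The following relations hold for all vector fields $X,Y,Z$: $$\overset{g}{P}(X,Y)Z=\frac{4}{n+2}\overset{0}{H}(X,Y)Z+\frac{n-2}{n+2}\overset{4}{H}(X,Y)Z,$$ $$\overset{g}{P}(X,Y)Z=\frac{4(n-1)}{n+2}\overset{0}{H}(X,Y)Z-\frac{2(n-2)}{n+2}\overset{1}{H}(X,Y)Z-\frac{n-2}{n+2}\overset{2}{H}(X,Y)Z,$$ $$\overset{g}{P}(X,Y)Z=\frac{4}{n+2}\overset{0}{H}(X,Y)Z+\frac{n-2}{n+2}\Big(2\overset{5}{H}(X,Z)Y-\overset{1}{H}(X,Z)Y+\overset{1}{H}(Z,Y)X\Big).$$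
   Context: A K\"ahler manifold $(\mathcal{M},g,A)$ is a Riemannian manifold $(\mathcal{M},g)$ of dimension $n=2k\ge4$ with a $(1,1)$ tensor field $A$ satisfying $A^2=-I$, $g(AX,AY)=g(X,Y)$ and $\overset{g}{\nabla}A=0$, where $\overset{g}{\nabla}$ is the Levi-Civita connection. $\overset{g}{R}$ is the Riemannian curvature tensor of $g$, $\overset{g}{R}(X,Y)Z=\overset{g}{\nabla}_X\overset{g}{\nabla}_YZ-\overset{g}{\nabla}_Y\overset{g}{\nabla}_XZ-\overset{g}{\nabla}_{[X,Y]}Z$, and $\overset{g}{R}ic(Y,Z)=\mathrm{Trace}\{X\mapsto\overset{g}{R}(X,Y)Z\}$. The holomorphically projective curvature tensor is $$\overset{g}{P}(X,Y)Z=\overset{g}{R}(X,Y)Z+\tfrac{1}{n+2}\big(\overset{g}{R}ic(X,Z)Y-\overset{g}{R}ic(Y,Z)X\big)-\tfrac{1}{n+2}\big(\overset{g}{R}ic(X,AZ)AY-\overset{g}{R}ic(Y,AZ)AX+2\overset{g}{R}ic(X,AY)AZ\big).$$ For a 1-form $\pi$ put $$\overset{0}{D}(X,Y)=(\overset{g}{\nabla}_X\pi)(Y)+\tfrac12\pi(X)\pi(AY)+\tfrac12\pi(Y)\pi(AX),\quad \overset{1}{D}(X,Y)=(\overset{g}{\nabla}_X\pi)(Y)-(\overset{g}{\nabla}_Y\pi)(X),$$ $$\overset{2}{D}(X,Y)=(\overset{g}{\nabla}_X\pi)(Y)+\pi(Y)\pi(AX),\quad \overset{3}{D}(X,Y)=(\overset{g}{\nabla}_X\pi)(Y)+\pi(X)\pi(AY),$$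 and define the curvature tensors $$\overset{0}{R}(X,Y)Z=\overset{g}{R}(X,Y)Z-\tfrac12\big(\overset{0}{D}(X,Y)-\overset{0}{D}(Y,X)\big)AZ-\tfrac12\overset{0}{D}(X,Z)AY+\tfrac12\overset{0}{D}(Y,Z)AX+\tfrac14\pi(Z)\big(\pi(Y)X-\pi(X)Y\big),$$ $$\overset{1}{R}(X,Y)Z=\overset{g}{R}(X,Y)Z-\overset{1}{D}(X,Y)AZ,$$ $$\overset{2}{R}(X,Y)Z=\overset{g}{R}(X,Y)Z-\overset{2}{D}(X,Z)AY+\overset{2}{D}(Y,Z)AX,$$ $$\overset{3}{R}(X,Y)Z=\overset{g}{R}(X,Y)Z-\overset{2}{D}(X,Y)AZ+\overset{3}{D}(Y,Z)AX,$$ $$\overset{4}{R}(X,Y)Z=\overset{g}{R}(X,Y)Z-\overset{3}{D}(X,Y)AZ+\overset{3}{D}(Y,Z)AX+\pi(Z)\big(\pi(Y)X-\pi(X)Y\big),$$ $$\overset{5}{R}(X,Y)Z=\overset{g}{R}(X,Y)Z-\tfrac12\big(\overset{2}{D}(X,Y)-\overset{3}{D}(Y,X)\big)AZ-\tfrac12\overset{3}{D}(X,Z)AY+\tfrac12\overset{2}{D}(Y,Z)AX-\tfrac12\pi(Y)\big(\pi(X)Z-\pi(Z)X\big),$$ with $\overset{\theta}{R}ic(Y,Z)=\mathrm{Trace}\{X\mapsto\overset{\theta}{R}(X,Y)Z\}$ for $\theta=0,\dots,5$ and $\overset{\theta}{'R}(X,Y)=\mathrm{Trace}\{Z\mapsto\overset{\theta}{R}(X,Y)Z\}$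 for $\theta=3,4$. Finally define $$\overset{1}{H}(X,Y)Z=\overset{1}{R}(X,Y)Z+\overset{1}{R}ic(Y,AX)AZ,$$ $$\overset{2}{H}(X,Y)Z=\overset{2}{R}(X,Y)Z+\overset{2}{R}ic(AX,Z)AY-\overset{2}{R}ic(AY,Z)AX,$$ $$\begin{aligned}\overset{4}{H}(X,Y)Z={}&\overset{4}{R}(X,Y)Z-\overset{4}{'R}(AY,X)AZ+\overset{4}{'R}(AZ,Y)AX\\&-\tfrac{1}{n-1}\big(\overset{4}{R}ic(Y,Z)X-\overset{4}{R}ic(X,Z)Y-\overset{4}{'R}(AY,AZ)X+\overset{4}{'R}(AX,AZ)Y\big),\end{aligned}$$ $$\begin{aligned}\overset{5}{H}(X,Y)Z={}&\overset{5}{R}(X,Y)Z+\tfrac{1}{n-1}\big(\overset{5}{R}ic(X,Y)Z-\overset{5}{R}ic(Y,Z)X\big)-\tfrac{1}{2(n-1)}\big(\overset{1}{R}ic(X,Y)Z-\overset{1}{R}ic(Y,Z)X\big)\\&-\tfrac{1}{2(n-1)}\big(\overset{3}{'R}(AY,AX)Z-\overset{3}{'R}(AZ,AY)X\big)+\tfrac12\big(\overset{1}{R}ic(Y,AX)AZ-\overset{3}{R}ic(Z,AY)AX-\overset{3}{'R}(AZ,X)AY\big),\end{aligned}$$ $$\begin{aligned}\overset{0}{H}(X,Y)Z={}&\overset{0}{R}(X,Y)Z+\tfrac{1}{n-1}\big(\overset{0}{R}ic(X,Z)Y-\overset{0}{R}ic(Y,Z)X\big)-\tfrac{1}{2(n-1)}\big(\overset{1}{R}ic(X,Z)Y-\overset{1}{R}ic(Y,Z)X\big)\\&-\tfrac{1}{4(n-1)}\big(\overset{3}{R}ic(Z,X)Y-\overset{3}{R}ic(Z,Y)X+\overset{3}{'R}(AZ,AX)Y-\overset{3}{'R}(AZ,AY)X\big)\\&+\tfrac14\big(2\overset{1}{R}ic(Y,AX)AZ+\overset{3}{R}ic(Z,AX)AY-\overset{3}{R}ic(Z,AY)AX\big)-\tfrac14\big(\overset{3}{'R}(AZ,X)AY-\overset{3}{'R}(AZ,Y)AX\big).\end{aligned}$$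 *)

theory Defs
  imports "HOL-Analysis.Analysis"
begin

section \<open>Smooth manifolds modelled on \<open>real ^ 'n\<close>\<close>

text \<open>
  Smoothness is only used for \<open>S\<close> open, where the Frechet derivative at a point of \<open>S\<close> does not
  depend on the values outside \<open>S\<close>. \<open>Ck_on k S f\<close> says that all iterated directional derivatives
  of order at most \<open>k\<close> exist as Frechet derivatives and are continuous.
\<close>

primrec Ck_on :: "nat \<Rightarrow> 'v::real_normed_vector set \<Rightarrow> ('v \<Rightarrow> 'w::real_normed_vector) \<Rightarrow> bool" where
  "Ck_on 0 S f \<longleftrightarrow> continuous_on S f"
| "Ck_on (Suc k) S f \<longleftrightarrow>
     (\<forall>x\<in>S. f differentiable (at x)) \<and> (\<forall>v. Ck_on k S (\<lambda>x. frechet_derivative f (at x) v))"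

definition smooth_on :: "'v::real_normed_vector set \<Rightarrow> ('v \<Rightarrow> 'w::real_normed_vector) \<Rightarrow> bool" where
  "smooth_on S f \<longleftrightarrow> (\<forall>k. Ck_on k S f)"

text \<open>A chart is a pair of its domain and its coordinate map.\<close>

type_synonym ('a, 'n) chart = "'a set \<times> ('a \<Rightarrow> real ^ 'n)"

definition chart_inv :: "('a, 'n) chart \<Rightarrow> real ^ 'n \<Rightarrow> 'a" where
  "chart_inv c = inv_into (fst c) (snd c)"

definition smooth_atlas :: "('a::topological_space, 'n::finite) chart set \<Rightarrow> bool" where
  "smooth_atlas \<A> \<longleftrightarrow>
     (\<forall>c\<in>\<A>. open (fst c) \<and> open (snd c ` fst c) \<and>
        homeomorphism (fst c) (snd c ` fst c) (snd c) (chart_inv c)) \<and>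
     (\<Union>c\<in>\<A>. fst c) = UNIV \<and>
     (\<forall>c\<in>\<A>. \<forall>d\<in>\<A>. smooth_on (snd c ` (fst c \<inter> fst d)) (snd d \<circ> chart_inv c))"

definition smooth_fun :: "('a, 'n::finite) chart set \<Rightarrow> ('a \<Rightarrow> real) \<Rightarrow> bool" where
  "smooth_fun \<A> f \<longleftrightarrow> (\<forall>c\<in>\<A>. smooth_on (snd c ` fst c) (f \<circ> chart_inv c))"

text \<open>
  For every point \<open>p\<close> a chart \<open>chart_at \<A> p\<close> around \<open>p\<close> is chosen once and for all, and the tangent
  space at \<open>p\<close> is identified with \<open>real ^ 'n\<close> through this chart: a tangent vector at \<open>p\<close> is given by
  its components in \<open>chart_at \<A> p\<close>. Its components in another chart \<open>c\<close> around \<open>p\<close> are obtained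
  by applying the Jacobian of the change of coordinates (\<open>components\<close>). So a vector field is a
  function \<open>'a \<Rightarrow> real ^ 'n\<close>, but its smoothness is that of its components in each chart of the
  atlas, not that of this function.
\<close>

definition chart_at :: "('a, 'n::finite) chart set \<Rightarrow> 'a \<Rightarrow> ('a, 'n) chart" where
  "chart_at \<A> p = (SOME c. c \<in> \<A> \<and> p \<in> fst c)"

definition components ::
  "('a, 'n::finite) chart set \<Rightarrow> ('a, 'n) chart \<Rightarrow> 'a \<Rightarrow> real ^ 'n \<Rightarrow> real ^ 'n" where
  "components \<A> c p v =
     frechet_derivative (snd c \<circ> chart_inv (chart_at \<A> p)) (at (snd (chart_at \<A> p) p)) v"

type_synonym ('a, 'n) vfield = "'a \<Rightarrow> real ^ 'n"

definition chart_rep ::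
  "('a, 'n::finite) chart set \<Rightarrow> ('a, 'n) chart \<Rightarrow> ('a, 'n) vfield \<Rightarrow> real ^ 'n \<Rightarrow> real ^ 'n" where
  "chart_rep \<A> c X x = components \<A> c (chart_inv c x) (X (chart_inv c x))"

definition smooth_vfield :: "('a, 'n::finite) chart set \<Rightarrow> ('a, 'n) vfield \<Rightarrow> bool" where
  "smooth_vfield \<A> X \<longleftrightarrow> (\<forall>c\<in>\<A>. smooth_on (snd c ` fst c) (chart_rep \<A> c X))"

text \<open>The derivative \<open>X f\<close> of a function in the direction of a vector field.\<close>

definition vderiv ::
  "('a, 'n::finite) chart set \<Rightarrow> ('a, 'n) vfield \<Rightarrow> ('a \<Rightarrow> real) \<Rightarrow> 'a \<Rightarrow> real" where
  "vderiv \<A> X f p =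
     frechet_derivative (f \<circ> chart_inv (chart_at \<A> p)) (at (snd (chart_at \<A> p) p)) (X p)"

text \<open>The Lie bracket, with components \<open>[X, Y]\<^sup>i = X\<^sup>j \<partial>\<^sub>j Y\<^sup>i - Y\<^sup>j \<partial>\<^sub>j X\<^sup>i\<close>.\<close>

definition lie_bracket ::
  "('a, 'n::finite) chart set \<Rightarrow> ('a, 'n) vfield \<Rightarrow> ('a, 'n) vfield \<Rightarrow> ('a, 'n) vfield" where
  "lie_bracket \<A> X Y p =
     (let c = chart_at \<A> p in
        frechet_derivative (chart_rep \<A> c Y) (at (snd c p)) (X p) -
        frechet_derivative (chart_rep \<A> c X) (at (snd c p)) (Y p))"

section \<open>Kaehler manifolds\<close>

type_synonym ('a, 'n) metric = "'a \<Rightarrow> real ^ 'n \<Rightarrow> real ^ 'n \<Rightarrow> real"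
type_synonym ('a, 'n) endo_field = "'a \<Rightarrow> real ^ 'n \<Rightarrow> real ^ 'n"
type_synonym ('a, 'n) one_form = "'a \<Rightarrow> real ^ 'n \<Rightarrow> real"
type_synonym ('a, 'n) connection = "('a, 'n) vfield \<Rightarrow> ('a, 'n) vfield \<Rightarrow> ('a, 'n) vfield"

definition riemannian_metric :: "('a, 'n::finite) chart set \<Rightarrow> ('a, 'n) metric \<Rightarrow> bool" where
  "riemannian_metric \<A> g \<longleftrightarrow>
     (\<forall>p. bilinear (g p) \<and> (\<forall>v w. g p v w = g p w v) \<and> (\<forall>v. v \<noteq> 0 \<longrightarrow> g p v v > 0)) \<and>
     (\<forall>X Y. smooth_vfield \<A> X \<longrightarrow> smooth_vfield \<A> Y \<longrightarrow> smooth_fun \<A> (\<lambda>p. g p (X p) (Y p)))"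

definition tensor_field_1_1 :: "('a, 'n::finite) chart set \<Rightarrow> ('a, 'n) endo_field \<Rightarrow> bool" where
  "tensor_field_1_1 \<A> A \<longleftrightarrow>
     (\<forall>p. linear (A p)) \<and> (\<forall>X. smooth_vfield \<A> X \<longrightarrow> smooth_vfield \<A> (\<lambda>p. A p (X p)))"

definition smooth_one_form :: "('a, 'n::finite) chart set \<Rightarrow> ('a, 'n) one_form \<Rightarrow> bool" where
  "smooth_one_form \<A> \<pi> \<longleftrightarrow>
     (\<forall>p. linear (\<pi> p)) \<and> (\<forall>X. smooth_vfield \<A> X \<longrightarrow> smooth_fun \<A> (\<lambda>p. \<pi> p (X p)))"

text \<open>Only the values of a connection on smooth vector fields are meaningful.\<close>

definition affine_connection :: "('a, 'n::finite) chart set \<Rightarrow> ('a, 'n) connection \<Rightarrow> bool" where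
  "affine_connection \<A> nab \<longleftrightarrow>
     (\<forall>X Y. smooth_vfield \<A> X \<longrightarrow> smooth_vfield \<A> Y \<longrightarrow> smooth_vfield \<A> (nab X Y)) \<and>
     (\<forall>X X' Y. smooth_vfield \<A> X \<longrightarrow> smooth_vfield \<A> X' \<longrightarrow> smooth_vfield \<A> Y \<longrightarrow>
        (\<forall>p. nab (\<lambda>q. X q + X' q) Y p = nab X Y p + nab X' Y p)) \<and>
     (\<forall>X Y Y'. smooth_vfield \<A> X \<longrightarrow> smooth_vfield \<A> Y \<longrightarrow> smooth_vfield \<A> Y' \<longrightarrow>
        (\<forall>p. nab X (\<lambda>q. Y q + Y' q) p = nab X Y p + nab X Y' p)) \<and>
     (\<forall>f X Y. smooth_fun \<A> f \<longrightarrow> smooth_vfield \<A> X \<longrightarrow> smooth_vfield \<A> Y \<longrightarrow>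
        (\<forall>p. nab (\<lambda>q. f q *\<^sub>R X q) Y p = f p *\<^sub>R nab X Y p)) \<and>
     (\<forall>f X Y. smooth_fun \<A> f \<longrightarrow> smooth_vfield \<A> X \<longrightarrow> smooth_vfield \<A> Y \<longrightarrow>
        (\<forall>p. nab X (\<lambda>q. f q *\<^sub>R Y q) p = vderiv \<A> X f p *\<^sub>R Y p + f p *\<^sub>R nab X Y p))"

definition levi_civita ::
  "('a, 'n::finite) chart set \<Rightarrow> ('a, 'n) metric \<Rightarrow> ('a, 'n) connection \<Rightarrow> bool" where
  "levi_civita \<A> g nab \<longleftrightarrow>
     affine_connection \<A> nab \<and>
     (\<forall>X Y. smooth_vfield \<A> X \<longrightarrow> smooth_vfield \<A> Y \<longrightarrow>
        (\<forall>p. nab X Y p - nab Y X p = lie_bracket \<A> X Y p)) \<and>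
     (\<forall>X Y Z. smooth_vfield \<A> X \<longrightarrow> smooth_vfield \<A> Y \<longrightarrow> smooth_vfield \<A> Z \<longrightarrow>
        (\<forall>p. vderiv \<A> X (\<lambda>q. g q (Y q) (Z q)) p = g p (nab X Y p) (Z p) + g p (Y p) (nab X Z p)))"

text \<open>\<open>kahler_manifold \<A> g A nab\<close>: the manifold with atlas \<open>\<A>\<close>, metric \<open>g\<close> and structure tensor \<open>A\<close>
  is Kaehler, and \<open>nab\<close> is its Levi-Civita connection.\<close>

definition kahler_manifold ::
  "('a::{t2_space, second_countable_topology}, 'n::finite) chart set \<Rightarrow> ('a, 'n) metric \<Rightarrow>
   ('a, 'n) endo_field \<Rightarrow> ('a, 'n) connection \<Rightarrow> bool" where
  "kahler_manifold \<A> g A nab \<longleftrightarrow>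
     even CARD('n) \<and> CARD('n) \<ge> 4 \<and>
     smooth_atlas \<A> \<and> riemannian_metric \<A> g \<and> levi_civita \<A> g nab \<and> tensor_field_1_1 \<A> A \<and>
     (\<forall>p v. A p (A p v) = - v) \<and>
     (\<forall>p v w. g p (A p v) (A p w) = g p v w) \<and>
     (\<forall>X Y. smooth_vfield \<A> X \<longrightarrow> smooth_vfield \<A> Y \<longrightarrow>
        (\<forall>p. nab X (\<lambda>q. A q (Y q)) p - A p (nab X Y p) = 0))"

definition qsm_A_connection ::
  "('a, 'n::finite) chart set \<Rightarrow> ('a, 'n) endo_field \<Rightarrow> ('a, 'n) connection \<Rightarrow>
   ('a, 'n) one_form \<Rightarrow> ('a, 'n) connection \<Rightarrow> bool" where
  "qsm_A_connection \<A> A nab \<pi> nab1 \<longleftrightarrow>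
     smooth_one_form \<A> \<pi> \<and>
     (\<forall>X Y. smooth_vfield \<A> X \<longrightarrow> smooth_vfield \<A> Y \<longrightarrow>
        (\<forall>p. nab1 X Y p = nab X Y p - \<pi> p (X p) *\<^sub>R A p (Y p)))"

section \<open>Curvature tensors\<close>

type_synonym ('a, 'n) tensor_1_3 =
  "('a, 'n) vfield \<Rightarrow> ('a, 'n) vfield \<Rightarrow> ('a, 'n) vfield \<Rightarrow> ('a, 'n) vfield"
type_synonym ('a, 'n) tensor_0_2 = "('a, 'n) vfield \<Rightarrow> ('a, 'n) vfield \<Rightarrow> 'a \<Rightarrow> real"

text \<open>
  The trace at \<open>p\<close> of a tensorial operator \<open>T\<close> on vector fields, i.e. the trace of the linear map on
  the tangent space at \<open>p\<close> that sends \<open>v\<close> to the value at \<open>p\<close> of \<open>T V\<close> for any smooth vector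
  field \<open>V\<close> with value \<open>v\<close> at \<open>p\<close>.
\<close>

definition extend_vector :: "('a, 'n::finite) chart set \<Rightarrow> 'a \<Rightarrow> real ^ 'n \<Rightarrow> ('a, 'n) vfield" where
  "extend_vector \<A> p v = (SOME V. smooth_vfield \<A> V \<and> V p = v)"

definition trace_at ::
  "('a, 'n::finite) chart set \<Rightarrow> 'a \<Rightarrow> (('a, 'n) vfield \<Rightarrow> ('a, 'n) vfield) \<Rightarrow> real" where
  "trace_at \<A> p T = trace (matrix (\<lambda>v. T (extend_vector \<A> p v) p))"

text \<open>
  For a tensor \<open>T\<close> of type (1,3), \<open>ricci \<A> T Y Z\<close> is the trace of \<open>X \<mapsto> T X Y Z\<close> and \<open>trace3 \<A> T X Y\<close>
  the trace of \<open>Z \<mapsto> T X Y Z\<close>.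
\<close>

definition ricci ::
  "('a, 'n::finite) chart set \<Rightarrow> ('a, 'n) tensor_1_3 \<Rightarrow> ('a, 'n) tensor_0_2" where
  "ricci \<A> T Y Z p = trace_at \<A> p (\<lambda>X. T X Y Z)"

definition trace3 ::
  "('a, 'n::finite) chart set \<Rightarrow> ('a, 'n) tensor_1_3 \<Rightarrow> ('a, 'n) tensor_0_2" where
  "trace3 \<A> T X Y p = trace_at \<A> p (\<lambda>Z. T X Y Z)"

text \<open>
  The locale carries no assumptions; it only fixes the data on which the tensors depend:
  the atlas, the structure tensor \<open>A\<close>, the Levi-Civita connection and the 1-form \<open>\<pi>\<close>.
  \<open>J X\<close> stands for the vector field \<open>A X\<close> and \<open>\<pi>F X\<close> for the function \<open>\<pi>(X)\<close>; the dimension is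
  \<open>CARD('n)\<close>.
\<close>

locale kahler_tensors =
  fixes \<A> :: "('a, 'n::finite) chart set"
    and A :: "('a, 'n) endo_field"
    and nab :: "('a, 'n) connection"
    and \<pi> :: "('a, 'n) one_form"
begin

abbreviation J :: "('a, 'n) vfield \<Rightarrow> ('a, 'n) vfield" where
  "J X \<equiv> (\<lambda>q. A q (X q))"

abbreviation \<pi>F :: "('a, 'n) vfield \<Rightarrow> 'a \<Rightarrow> real" where
  "\<pi>F X \<equiv> (\<lambda>q. \<pi> q (X q))"

abbreviation Ric :: "('a, 'n) tensor_1_3 \<Rightarrow> ('a, 'n) tensor_0_2" where
  "Ric \<equiv> ricci \<A>"

abbreviation Tr3 :: "('a, 'n) tensor_1_3 \<Rightarrow> ('a, 'n) tensor_0_2" where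
  "Tr3 \<equiv> trace3 \<A>"

definition Rg :: "('a, 'n) tensor_1_3" where
  "Rg X Y Z p = nab X (nab Y Z) p - nab Y (nab X Z) p - nab (lie_bracket \<A> X Y) Z p"

definition P :: "('a, 'n) tensor_1_3" where
  "P X Y Z p = Rg X Y Z p
     + (1 / (real CARD('n) + 2)) *\<^sub>R (Ric Rg X Z p *\<^sub>R Y p - Ric Rg Y Z p *\<^sub>R X p)
     - (1 / (real CARD('n) + 2)) *\<^sub>R (Ric Rg X (J Z) p *\<^sub>R J Y p - Ric Rg Y (J Z) p *\<^sub>R J X p
                        + (2 * Ric Rg X (J Y) p) *\<^sub>R J Z p)"

text \<open>\<open>nab_form X Y\<close> is \<open>(\<nabla>\<^sub>X \<pi>)(Y)\<close>.\<close>

definition nab_form :: "('a, 'n) tensor_0_2" where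
  "nab_form X Y p = vderiv \<A> X (\<pi>F Y) p - \<pi>F (nab X Y) p"

definition D0 :: "('a, 'n) tensor_0_2" where
  "D0 X Y p = nab_form X Y p + 1/2 * \<pi>F X p * \<pi>F (J Y) p + 1/2 * \<pi>F Y p * \<pi>F (J X) p"

definition D1 :: "('a, 'n) tensor_0_2" where
  "D1 X Y p = nab_form X Y p - nab_form Y X p"

definition D2 :: "('a, 'n) tensor_0_2" where
  "D2 X Y p = nab_form X Y p + \<pi>F Y p * \<pi>F (J X) p"

definition D3 :: "('a, 'n) tensor_0_2" where
  "D3 X Y p = nab_form X Y p + \<pi>F X p * \<pi>F (J Y) p"

definition R0 :: "('a, 'n) tensor_1_3" where
  "R0 X Y Z p = Rg X Y Z p
     - (1/2 * (D0 X Y p - D0 Y X p)) *\<^sub>R J Z p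
     - (1/2 * D0 X Z p) *\<^sub>R J Y p
     + (1/2 * D0 Y Z p) *\<^sub>R J X p
     + (1/4 * \<pi>F Z p) *\<^sub>R (\<pi>F Y p *\<^sub>R X p - \<pi>F X p *\<^sub>R Y p)"

definition R1 :: "('a, 'n) tensor_1_3" where
  "R1 X Y Z p = Rg X Y Z p - D1 X Y p *\<^sub>R J Z p"

definition R2 :: "('a, 'n) tensor_1_3" where
  "R2 X Y Z p = Rg X Y Z p - D2 X Z p *\<^sub>R J Y p + D2 Y Z p *\<^sub>R J X p"

definition R3 :: "('a, 'n) tensor_1_3" where
  "R3 X Y Z p = Rg X Y Z p - D2 X Y p *\<^sub>R J Z p + D3 Y Z p *\<^sub>R J X p"

definition R4 :: "('a, 'n) tensor_1_3" where
  "R4 X Y Z p = Rg X Y Z p - D3 X Y p *\<^sub>R J Z p + D3 Y Z p *\<^sub>R J X p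
     + \<pi>F Z p *\<^sub>R (\<pi>F Y p *\<^sub>R X p - \<pi>F X p *\<^sub>R Y p)"

definition R5 :: "('a, 'n) tensor_1_3" where
  "R5 X Y Z p = Rg X Y Z p
     - (1/2 * (D2 X Y p - D3 Y X p)) *\<^sub>R J Z p
     - (1/2 * D3 X Z p) *\<^sub>R J Y p
     + (1/2 * D2 Y Z p) *\<^sub>R J X p
     - (1/2 * \<pi>F Y p) *\<^sub>R (\<pi>F X p *\<^sub>R Z p - \<pi>F Z p *\<^sub>R X p)"

definition H1 :: "('a, 'n) tensor_1_3" where
  "H1 X Y Z p = R1 X Y Z p + Ric R1 Y (J X) p *\<^sub>R J Z p"

definition H2 :: "('a, 'n) tensor_1_3" where
  "H2 X Y Z p = R2 X Y Z p + Ric R2 (J X) Z p *\<^sub>R J Y p - Ric R2 (J Y) Z p *\<^sub>R J X p"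

definition H4 :: "('a, 'n) tensor_1_3" where
  "H4 X Y Z p = R4 X Y Z p
     - Tr3 R4 (J Y) X p *\<^sub>R J Z p + Tr3 R4 (J Z) Y p *\<^sub>R J X p
     - (1 / (real CARD('n) - 1)) *\<^sub>R
         (Ric R4 Y Z p *\<^sub>R X p - Ric R4 X Z p *\<^sub>R Y p
          - Tr3 R4 (J Y) (J Z) p *\<^sub>R X p + Tr3 R4 (J X) (J Z) p *\<^sub>R Y p)"

definition H5 :: "('a, 'n) tensor_1_3" where
  "H5 X Y Z p = R5 X Y Z p
     + (1 / (real CARD('n) - 1)) *\<^sub>R (Ric R5 X Y p *\<^sub>R Z p - Ric R5 Y Z p *\<^sub>R X p)
     - (1 / (2 * (real CARD('n) - 1))) *\<^sub>R (Ric R1 X Y p *\<^sub>R Z p - Ric R1 Y Z p *\<^sub>R X p)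
     - (1 / (2 * (real CARD('n) - 1))) *\<^sub>R (Tr3 R3 (J Y) (J X) p *\<^sub>R Z p - Tr3 R3 (J Z) (J Y) p *\<^sub>R X p)
     + (1/2) *\<^sub>R (Ric R1 Y (J X) p *\<^sub>R J Z p - Ric R3 Z (J Y) p *\<^sub>R J X p
                - Tr3 R3 (J Z) X p *\<^sub>R J Y p)"

definition H0 :: "('a, 'n) tensor_1_3" where
  "H0 X Y Z p = R0 X Y Z p
     + (1 / (real CARD('n) - 1)) *\<^sub>R (Ric R0 X Z p *\<^sub>R Y p - Ric R0 Y Z p *\<^sub>R X p)
     - (1 / (2 * (real CARD('n) - 1))) *\<^sub>R (Ric R1 X Z p *\<^sub>R Y p - Ric R1 Y Z p *\<^sub>R X p)
     - (1 / (4 * (real CARD('n) - 1))) *\<^sub>R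
         (Ric R3 Z X p *\<^sub>R Y p - Ric R3 Z Y p *\<^sub>R X p
          + Tr3 R3 (J Z) (J X) p *\<^sub>R Y p - Tr3 R3 (J Z) (J Y) p *\<^sub>R X p)
     + (1/4) *\<^sub>R ((2 * Ric R1 Y (J X) p) *\<^sub>R J Z p
                + Ric R3 Z (J X) p *\<^sub>R J Y p - Ric R3 Z (J Y) p *\<^sub>R J X p)
     - (1/4) *\<^sub>R (Tr3 R3 (J Z) X p *\<^sub>R J Y p - Tr3 R3 (J Z) Y p *\<^sub>R J X p)"

end

end

(*
  Taking traces shows that in every H the terms with pi and nabla pi cancel, and H differs from the
  Riemannian curvature tensor R only by explicit terms in Ric and in rho(X, Y) = Ric(X, AY).  The
  first two relations are then a comparison of coefficients, and the third also uses the first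
  Bianchi identity, R(X, Z)Y + R(Z, Y)X = R(X, Y)Z.

  What has to be supplied is the behaviour of the curvature tensors at a point: tensoriality, from
  bump functions, and the symmetries of R, from [X, Y]f = X(Yf) - Y(Xf).  Symmetry of Ric
  and the vanishing of the traces of A and of R(X, Y) follow from the fact that an endomorphism and
  its g-adjoint have the same trace.
*)

theory Submission
  imports Defs
begin

section \<open>Calculus of smooth functions\<close>

text \<open>Why the pi-terms cancel: they enter the curvature tensors as multiples of A or of the
  identity and as rank-one maps such as X -> D(X,Y) AZ, whose trace is D(AZ,Y). Inserting a further
  A into such a trace and using A^2 = -I returns D(X,Y) up to sign, so a suitably twisted trace
  removes the term it came from. The explicit quadratic terms of R0, R4 and R5 reach the Ricci
  traces with a factor n-1, which the division by n-1 in the H's undoes.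

  The obstacle is that tangent vectors are written in a chart chosen anew at every point, and that
  traces are formed with arbitrarily chosen extensions of tangent vectors. Such choices need not
  vary continuously, so every derivative is moved into one fixed chart, and a trace can be evaluated
  only once the operator is known to depend on values at p alone. After that, curvature, nabla pi
  and pi are multilinear maps on one copy of R^n, and the rest is algebra.\<close>

lemma has_derivative_frechet:
  "f differentiable (at x) \<Longrightarrow> (f has_derivative frechet_derivative f (at x)) (at x)"
  by (simp add: frechet_derivative_works)

lemma Ck_on_cong:
  assumes "open S" "\<And>x. x \<in> S \<Longrightarrow> f x = g x"
  shows "Ck_on k S f \<longleftrightarrow> Ck_on k S g"
  using assms(2)
proof (induction k arbitrary: f g)
  case 0
  then show ?case by (simp cong: continuous_on_cong)
next
  case (Suc k)
  have *: "(f has_derivative D) (at x) \<longleftrightarrow> (g has_derivative D) (at x)" if "x \<in> S" for x D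
    using has_derivative_transform_within_open[OF _ assms(1) that] Suc.prems by metis
  then have diff: "f differentiable (at x) \<longleftrightarrow> g differentiable (at x)" if "x \<in> S" for x
    using *[OF that] unfolding differentiable_def by blast
  \<comment> \<open>Both sides are choices from the same set of candidate derivatives, so they agree
    even where no derivative exists.\<close>
  have D: "frechet_derivative f (at x) = frechet_derivative g (at x)" if "x \<in> S" for x
    using * that by (simp add: frechet_derivative_def)
  have "Ck_on k S (\<lambda>x. frechet_derivative f (at x) v) \<longleftrightarrow> Ck_on k S (\<lambda>x. frechet_derivative g (at x) v)" for v
    by (rule Suc.IH) (simp add: D)
  then show ?case using diff by simp
qed

text \<open>\<open>Ck_on\<close> is phrased with the chosen \<open>frechet_derivative\<close>; this
  rule accepts any explicit derivative formula, so the closure properties below become inductions on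
  k carried by the usual differentiation rules.\<close>

lemma Ck_on_SucI:
  assumes "open S" "\<And>x. x \<in> S \<Longrightarrow> (f has_derivative f' x) (at x)"
    and "\<And>v. Ck_on k S (\<lambda>x. f' x v)"
  shows "Ck_on (Suc k) S f"
proof -
  have "frechet_derivative f (at x) = f' x" if "x \<in> S" for x
    using assms(2)[OF that] by (metis frechet_derivative_at)
  then have "Ck_on k S (\<lambda>x. frechet_derivative f (at x) v)" for v
    using assms(3)[of v] by (subst Ck_on_cong[OF assms(1)]) auto
  with assms(2) show ?thesis by (auto simp: differentiable_def)
qed

lemma Ck_on_subset: "Ck_on k S f \<Longrightarrow> T \<subseteq> S \<Longrightarrow> Ck_on k T f"
  by (induction k arbitrary: f) (auto intro: continuous_on_subset)

text \<open>The definition lists no conditions of lower order; they come back by induction, down to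
  "differentiable implies continuous". Product and chain rule need them because they mix
  differentiated and undifferentiated factors.\<close>

lemma Ck_on_SucD: "Ck_on (Suc k) S f \<Longrightarrow> Ck_on k S f"
proof (induction k arbitrary: f)
  case 0
  then have "isCont f x" if "x \<in> S" for x
    using that by (simp add: differentiable_imp_continuous_within)
  then show ?case by (simp add: continuous_at_imp_continuous_on)
next
  case (Suc k)
  then have "\<And>v. Ck_on k S (\<lambda>x. frechet_derivative f (at x) v)" by (auto simp del: Ck_on.simps(1))
  with Suc.prems show ?case by simp
qed

text \<open>Serves to glue a smooth function on one chart domain to the zero function
  elsewhere.\<close>

lemma Ck_on_local:
  assumes "\<And>x. x \<in> S \<Longrightarrow> \<exists>U. open U \<and> x \<in> U \<and> Ck_on k U f"
  shows "Ck_on k S f"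
  using assms
proof (induction k arbitrary: f)
  case 0
  then show ?case
    by (simp add: continuous_on_eq_continuous_within)
      (metis at_within_open continuous_at_imp_continuous_at_within)
next
  case (Suc k)
  have "f differentiable (at x)" if "x \<in> S" for x
    using Suc.prems[OF that] by (meson Ck_on.simps(2))
  moreover have "Ck_on k S (\<lambda>x. frechet_derivative f (at x) v)" for v
  proof (rule Suc.IH)
    fix x assume "x \<in> S"
    with Suc.prems obtain U where "open U" "x \<in> U" "Ck_on (Suc k) U f" by blast
    then show "\<exists>U. open U \<and> x \<in> U \<and> Ck_on k U (\<lambda>x. frechet_derivative f (at x) v)" by auto
  qed
  ultimately show ?case by simp
qed

lemma Ck_on_const: "Ck_on k S (\<lambda>x. c)"
  by (induction k arbitrary: c) auto

lemma Ck_on_linear: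
  assumes "open S" "bounded_linear L" "Ck_on k S f"
  shows "Ck_on k S (\<lambda>x. L (f x))"
  using assms(3)
proof (induction k arbitrary: f)
  case 0
  then show ?case
    using assms(2) by (simp add: bounded_linear.continuous_on)
next
  case (Suc k)
  show ?case
    by (rule Ck_on_SucI[OF assms(1), where f' = "\<lambda>x v. L (frechet_derivative f (at x) v)"])
      (use Suc in \<open>auto intro: bounded_linear.has_derivative[OF assms(2)] has_derivative_frechet\<close>)
qed

lemma Ck_on_add:
  assumes "open S" "Ck_on k S f" "Ck_on k S g"
  shows "Ck_on k S (\<lambda>x. f x + g x)"
  using assms(2,3)
proof (induction k arbitrary: f g)
  case 0
  then show ?case by (simp add: continuous_on_add)
next
  case (Suc k)
  show ?case
    by (rule Ck_on_SucI[OF assms(1), where f' = "\<lambda>x v. frechet_derivative f (at x) v + frechet_derivative g (at x) v"])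
      (use Suc in \<open>auto intro!: has_derivative_add has_derivative_frechet\<close>)
qed

lemma Ck_on_sum:
  assumes "open S" "\<And>i. i \<in> I \<Longrightarrow> Ck_on k S (f i)"
  shows "Ck_on k S (\<lambda>x. \<Sum>i\<in>I. f i x)"
  using assms(2)
  by (induction I rule: infinite_finite_induct) (auto intro: Ck_on_const Ck_on_add[OF assms(1)])

lemma Ck_on_bilinear:
  assumes "open S" "bounded_bilinear B" "Ck_on k S f" "Ck_on k S g"
  shows "Ck_on k S (\<lambda>x. B (f x) (g x))"
  using assms(3,4)
proof (induction k arbitrary: f g)
  case 0
  then show ?case
    using assms(2) by (simp add: bounded_bilinear.continuous_on)
next
  case (Suc k)
  note fk = Ck_on_SucD[OF Suc.prems(1)] and gk = Ck_on_SucD[OF Suc.prems(2)]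
  show ?case
    by (rule Ck_on_SucI[OF assms(1), where f' = "\<lambda>x v. B (f x) (frechet_derivative g (at x) v) +
          B (frechet_derivative f (at x) v) (g x)"])
      (use Suc fk gk in \<open>auto intro!: bounded_bilinear.FDERIV[OF assms(2)] has_derivative_frechet
          Ck_on_add[OF assms(1)]\<close>)
qed

lemma linear_euclidean_expand:
  fixes L :: "'m::euclidean_space \<Rightarrow> 'w::real_normed_vector"
  assumes "linear L"
  shows "L y = (\<Sum>b\<in>Basis. (y \<bullet> b) *\<^sub>R L b)"
proof -
  have "L y = L (\<Sum>b\<in>Basis. (y \<bullet> b) *\<^sub>R b)" by (simp add: euclidean_representation)
  then show ?thesis by (simp add: linear_sum[OF assms] linear_cmul[OF assms])
qed

lemma Ck_on_scaleR_inner: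
  assumes "open S" "Ck_on k S f" "Ck_on k S g"
  shows "Ck_on k S (\<lambda>x. (f x \<bullet> b) *\<^sub>R g x)"
  by (intro Ck_on_bilinear[OF assms(1) bounded_bilinear_scaleR _ assms(3)]
      Ck_on_linear[OF assms(1) bounded_linear_inner_left] assms(2))

text \<open>\<open>Ck_on\<close> controls derivatives along fixed vectors only, whereas the chain
  rule differentiates f along a direction that moves with x. Expanding this direction in the basis
  leaves products of its coordinates with fixed-direction derivatives of f composed with g, to which
  the induction hypothesis applies.\<close>

lemma Ck_on_compose:
  fixes f :: "'m::euclidean_space \<Rightarrow> 'w::real_normed_vector"
  assumes "open S" "open T" "g ` S \<subseteq> T" "Ck_on k T f" "Ck_on k S g"
  shows "Ck_on k S (\<lambda>x. f (g x))"
  using assms(4,5)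
proof (induction k arbitrary: f)
  case 0
  then show ?case using assms(3) by (auto intro: continuous_on_compose2)
next
  case (Suc k)
  have gk: "Ck_on k S g" by (rule Ck_on_SucD[OF Suc.prems(2)])
  have df: "f differentiable (at (g x))" if "x \<in> S" for x
    using that assms(3) Suc.prems(1) by auto
  have dg: "g differentiable (at x)" if "x \<in> S" for x
    using that Suc.prems(2) by auto
  let ?f' = "\<lambda>x v. \<Sum>b\<in>Basis. (frechet_derivative g (at x) v \<bullet> b) *\<^sub>R frechet_derivative f (at (g x)) b"
  show ?case
  proof (rule Ck_on_SucI[OF assms(1), where f' = ?f'])
    fix x assume x: "x \<in> S"
    have "((\<lambda>x. f (g x)) has_derivative
        (\<lambda>v. frechet_derivative f (at (g x)) (frechet_derivative g (at x) v))) (at x)"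
      by (rule has_derivative_compose[OF has_derivative_frechet[OF dg[OF x]]
            has_derivative_frechet[OF df[OF x]]])
    then show "((\<lambda>x. f (g x)) has_derivative ?f' x) (at x)"
      by (simp add: linear_euclidean_expand[OF linear_frechet_derivative[OF df[OF x]], symmetric])
  next
    fix v
    show "Ck_on k S (\<lambda>x. ?f' x v)"
      by (intro Ck_on_sum Ck_on_scaleR_inner assms(1) Suc.IH gk) (use Suc.prems in auto)
  qed
qed

lemma smooth_on_cong: "open S \<Longrightarrow> (\<And>x. x \<in> S \<Longrightarrow> f x = g x) \<Longrightarrow> smooth_on S f \<longleftrightarrow> smooth_on S g"
  unfolding smooth_on_def using Ck_on_cong by blast

lemma smooth_on_subset: "smooth_on S f \<Longrightarrow> T \<subseteq> S \<Longrightarrow> smooth_on T f"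
  unfolding smooth_on_def using Ck_on_subset by blast

lemma smooth_on_local:
  "(\<And>x. x \<in> S \<Longrightarrow> \<exists>U. open U \<and> x \<in> U \<and> smooth_on U f) \<Longrightarrow> smooth_on S f"
  unfolding smooth_on_def using Ck_on_local by metis

lemma smooth_on_const: "smooth_on S (\<lambda>x. c)"
  by (simp add: smooth_on_def Ck_on_const)

lemma smooth_on_linear:
  "open S \<Longrightarrow> bounded_linear L \<Longrightarrow> smooth_on S f \<Longrightarrow> smooth_on S (\<lambda>x. L (f x))"
  by (simp add: smooth_on_def Ck_on_linear)

lemma smooth_on_add:
  "open S \<Longrightarrow> smooth_on S f \<Longrightarrow> smooth_on S g \<Longrightarrow> smooth_on S (\<lambda>x. f x + g x)"
  by (simp add: smooth_on_def Ck_on_add)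

lemma smooth_on_bilinear:
  "open S \<Longrightarrow> bounded_bilinear B \<Longrightarrow> smooth_on S f \<Longrightarrow> smooth_on S g \<Longrightarrow>
    smooth_on S (\<lambda>x. B (f x) (g x))"
  by (simp add: smooth_on_def Ck_on_bilinear)

lemma smooth_on_scaleR:
  "open S \<Longrightarrow> smooth_on S f \<Longrightarrow> smooth_on S g \<Longrightarrow> smooth_on S (\<lambda>x. f x *\<^sub>R g x)"
  by (rule smooth_on_bilinear[OF _ bounded_bilinear_scaleR])

lemma smooth_on_ident: "open S \<Longrightarrow> smooth_on S (\<lambda>x. x)"
  unfolding smooth_on_def
proof
  fix k assume "open S"
  show "Ck_on k S (\<lambda>x. x)"
    by (cases k) (auto intro: Ck_on_const continuous_on_id)
qed

lemma smooth_on_compose: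
  fixes f :: "'m::euclidean_space \<Rightarrow> 'w::real_normed_vector"
  shows "open S \<Longrightarrow> open T \<Longrightarrow> g ` S \<subseteq> T \<Longrightarrow> smooth_on T f \<Longrightarrow> smooth_on S g \<Longrightarrow>
    smooth_on S (\<lambda>x. f (g x))"
  using Ck_on_compose by (simp add: smooth_on_def) blast

lemma smooth_on_differentiable: "smooth_on S f \<Longrightarrow> x \<in> S \<Longrightarrow> f differentiable (at x)"
  unfolding smooth_on_def by (metis Ck_on.simps(2))

lemma smooth_on_has_derivative:
  "smooth_on S f \<Longrightarrow> x \<in> S \<Longrightarrow> (f has_derivative frechet_derivative f (at x)) (at x)"
  by (simp add: has_derivative_frechet smooth_on_differentiable)

lemma smooth_on_deriv: "smooth_on S f \<Longrightarrow> smooth_on S (\<lambda>x. frechet_derivative f (at x) v)"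
  unfolding smooth_on_def by (metis Ck_on.simps(2))

lemma smooth_on_deriv_apply:
  fixes f :: "'m::euclidean_space \<Rightarrow> 'w::real_normed_vector"
  assumes "open S" "smooth_on S f" "smooth_on S X"
  shows "smooth_on S (\<lambda>x. frechet_derivative f (at x) (X x))"
proof -
  have "smooth_on S (\<lambda>x. \<Sum>b\<in>Basis. (X x \<bullet> b) *\<^sub>R frechet_derivative f (at x) b)"
    using assms smooth_on_deriv[OF assms(2)] unfolding smooth_on_def
    by (auto intro!: Ck_on_sum Ck_on_scaleR_inner)
  then show ?thesis
    by (subst smooth_on_cong[OF assms(1) linear_euclidean_expand[OF linear_frechet_derivative]])
      (auto intro: smooth_on_differentiable assms)
qed

section \<open>Symmetry of second derivatives and bump functions\<close>

lemma mvt_along: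
  fixes f :: "'v::real_normed_vector \<Rightarrow> real"
  assumes "t > 0" and "\<And>s. 0 \<le> s \<Longrightarrow> s \<le> t \<Longrightarrow> f differentiable (at (x + s *\<^sub>R u))"
  obtains s where "0 < s" "s < t" "f (x + t *\<^sub>R u) - f x = t * frechet_derivative f (at (x + s *\<^sub>R u)) u"
proof -
  let ?D = "\<lambda>s. frechet_derivative f (at (x + s *\<^sub>R u))"
  have lin: "linear (?D s)" if "0 \<le> s" "s \<le> t" for s
    using assms(2)[OF that] by (rule linear_frechet_derivative)
  have der: "((\<lambda>s. f (x + s *\<^sub>R u)) has_derivative (\<lambda>h. h * ?D s u)) (at s)"
    if "0 \<le> s" "s \<le> t" for s
  proof -
    have "((\<lambda>s. x + s *\<^sub>R u) has_derivative (\<lambda>h. h *\<^sub>R u)) (at s)"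
      by (auto intro!: derivative_eq_intros)
    from has_derivative_compose[OF this has_derivative_frechet[OF assms(2)[OF that]]]
    show ?thesis by (simp add: linear_cmul[OF lin[OF that]])
  qed
  have "\<exists>s. 0 < s \<and> s < t \<and> f (x + t *\<^sub>R u) - f (x + 0 *\<^sub>R u) = (t - 0) * ?D s u"
  proof -
    obtain z where "0 < z" "z < t" "f (x + t *\<^sub>R u) - f (x + 0 *\<^sub>R u) = (t - 0) * ?D z u"
      using mvt[of 0 t "\<lambda>s. f (x + s *\<^sub>R u)" "\<lambda>s h. h * ?D s u"] \<open>t > 0\<close> der
      by (smt (verit) continuous_at_imp_continuous_on atLeastAtMost_iff greaterThanLessThan_iff
          has_derivative_continuous)
    then show ?thesis by blast
  qed
  then show ?thesis using that by auto
qed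

text \<open>The mean value theorem twice: for \<open>f (y + t *\<^sub>R v) - f y\<close> along u,
  then for the u-derivative of f along v.\<close>

lemma second_difference_eq:
  fixes f :: "'v::real_normed_vector \<Rightarrow> real"
  assumes t: "t > 0"
    and dom: "\<And>a b. 0 \<le> a \<Longrightarrow> a \<le> t \<Longrightarrow> 0 \<le> b \<Longrightarrow> b \<le> t \<Longrightarrow> x + a *\<^sub>R u + b *\<^sub>R v \<in> S"
    and f: "Ck_on 2 S f"
  obtains a b where "0 < a" "a < t" "0 < b" "b < t"
    "f (x + t *\<^sub>R u + t *\<^sub>R v) - f (x + t *\<^sub>R u) - f (x + t *\<^sub>R v) + f x =
      t * t * frechet_derivative (\<lambda>y. frechet_derivative f (at y) u) (at (x + a *\<^sub>R u + b *\<^sub>R v)) v"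
proof -
  have f1: "f differentiable (at y)" if "y \<in> S" for y
    using f that by (simp add: numeral_2_eq_2)
  have f2: "(\<lambda>y. frechet_derivative f (at y) u) differentiable (at y)" if "y \<in> S" for y
    using f that by (simp add: numeral_2_eq_2)
  let ?h = "\<lambda>y. f (y + t *\<^sub>R v) - f y"
  have hd: "(?h has_derivative (\<lambda>w. frechet_derivative f (at (y + t *\<^sub>R v)) w - frechet_derivative f (at y) w)) (at y)"
    if "y \<in> S" "y + t *\<^sub>R v \<in> S" for y
  proof -
    have "((\<lambda>y. y + t *\<^sub>R v) has_derivative (\<lambda>w. w)) (at y)"
      by (auto intro!: derivative_eq_intros)
    from has_derivative_compose[OF this has_derivative_frechet[OF f1[OF that(2)]]]
    show ?thesis by (intro has_derivative_diff has_derivative_frechet f1 that)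
  qed
  have in1: "x + a *\<^sub>R u \<in> S" "x + a *\<^sub>R u + t *\<^sub>R v \<in> S" if "0 \<le> a" "a \<le> t" for a
    using dom[of a 0] dom[of a t] that t by auto
  obtain a where a: "0 < a" "a < t"
    and eq1: "?h (x + t *\<^sub>R u) - ?h x = t * frechet_derivative ?h (at (x + a *\<^sub>R u)) u"
    using mvt_along[OF t, of ?h x u] hd[OF in1] by (metis (no_types, lifting) differentiableI)
  have eq2: "frechet_derivative ?h (at (x + a *\<^sub>R u)) u =
      frechet_derivative f (at (x + a *\<^sub>R u + t *\<^sub>R v)) u - frechet_derivative f (at (x + a *\<^sub>R u)) u"
    using frechet_derivative_at[OF hd[OF in1[of a]]] a by (metis (no_types, lifting) less_imp_le)
  obtain b where b: "0 < b" "b < t"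
    and eq3: "frechet_derivative f (at (x + a *\<^sub>R u + t *\<^sub>R v)) u - frechet_derivative f (at (x + a *\<^sub>R u)) u =
      t * frechet_derivative (\<lambda>y. frechet_derivative f (at y) u) (at (x + a *\<^sub>R u + b *\<^sub>R v)) v"
    using mvt_along[OF t, of "\<lambda>y. frechet_derivative f (at y) u" "x + a *\<^sub>R u" v] f2 dom a
    by (metis (no_types, lifting) less_imp_le)
  show ?thesis
    by (rule that[OF a b]) (use eq1 eq2 eq3 in \<open>simp add: algebra_simps\<close>)
qed

text \<open>The second difference is symmetric in u and v, so the two mixed derivatives share a
  value, each at some point of a small parallelogram at x; continuity carries the equality to
  x.\<close>

lemma second_derivative_symmetric:
  fixes f :: "'v::real_normed_vector \<Rightarrow> real"
  assumes S: "open S" "x \<in> S" and f: "Ck_on 2 S f"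
  shows "frechet_derivative (\<lambda>y. frechet_derivative f (at y) u) (at x) v =
    frechet_derivative (\<lambda>y. frechet_derivative f (at y) v) (at x) u" (is "?P x = ?Q x")
proof -
  let ?P = "\<lambda>x. frechet_derivative (\<lambda>y. frechet_derivative f (at y) u) (at x) v"
  let ?Q = "\<lambda>x. frechet_derivative (\<lambda>y. frechet_derivative f (at y) v) (at x) u"
  have cont: "isCont ?P x" "isCont ?Q x"
    using f S by (auto simp: numeral_2_eq_2 continuous_on_eq_continuous_at)
  have "\<bar>?P x - ?Q x\<bar> \<le> e" if e: "e > 0" for e
  proof -
    have "\<forall>\<^sub>F y in nhds x. dist (?P y) (?P x) < e/2"
      using tendstoD[OF cont(1)[unfolded continuous_at_imp_continuous_at_within continuous_at], of "e/2"] e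
      by (simp add: eventually_at_filter eventually_mono continuous_at) (auto elim!: eventually_mono)
    moreover have "\<forall>\<^sub>F y in nhds x. dist (?Q y) (?Q x) < e/2"
      using tendstoD[OF cont(2)[unfolded continuous_at_imp_continuous_at_within continuous_at], of "e/2"] e
      by (simp add: eventually_at_filter eventually_mono continuous_at) (auto elim!: eventually_mono)
    moreover have "\<forall>\<^sub>F y in nhds x. y \<in> S"
      using S by (simp add: eventually_nhds_in_open)
    ultimately have "\<forall>\<^sub>F y in nhds x. y \<in> S \<and> dist (?P y) (?P x) < e/2 \<and> dist (?Q y) (?Q x) < e/2"
      by eventually_elim auto
    then obtain d where d: "d > 0"
      and near: "\<And>y. dist y x < d \<Longrightarrow> y \<in> S \<and> dist (?P y) (?P x) < e/2 \<and> dist (?Q y) (?Q x) < e/2"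
      unfolding eventually_nhds_metric by blast
    \<comment> \<open>All points used lie within \<open>t * (norm u + norm v + 1)\<close>, that is
      d/2, of x; the summand 1 keeps the denominator positive when u = v = 0.\<close>
    define t where "t = d / (2 * (norm u + norm v + 1))"
    have t: "t > 0" using d by (simp add: t_def add_nonneg_pos)
    have dist: "dist (x + a *\<^sub>R u + b *\<^sub>R v) x < d" if "0 \<le> a" "a \<le> t" "0 \<le> b" "b \<le> t" for a b
    proof -
      have "dist (x + a *\<^sub>R u + b *\<^sub>R v) x = norm (a *\<^sub>R u + b *\<^sub>R v)" by (simp add: dist_norm)
      also have "\<dots> \<le> a * norm u + b * norm v" using that norm_triangle_ineq[of "a *\<^sub>R u" "b *\<^sub>R v"] by simp
      also have "\<dots> \<le> t * norm u + t * norm v" using that by (intro add_mono mult_right_mono) auto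
      also have "\<dots> \<le> t * (norm u + norm v + 1)" using t by (simp add: algebra_simps)
      also have "\<dots> = d / 2" proof -
        have "norm u + norm v + 1 > 0" by (simp add: add_nonneg_pos)
        then show ?thesis unfolding t_def by (simp add: divide_simps)
      qed
      finally show ?thesis using d by simp
    qed
    obtain a b where ab: "0 < a" "a < t" "0 < b" "b < t"
      and "f (x + t *\<^sub>R u + t *\<^sub>R v) - f (x + t *\<^sub>R u) - f (x + t *\<^sub>R v) + f x =
        t * t * ?P (x + a *\<^sub>R u + b *\<^sub>R v)"
      using second_difference_eq[OF t _ f, of x u v] near dist by blast
    moreover have dist': "dist (x + a *\<^sub>R v + b *\<^sub>R u) x < d" if "0 \<le> a" "a \<le> t" "0 \<le> b" "b \<le> t" for a b
      using dist[of b a] that by (simp add: algebra_simps)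
    obtain a' b' where ab': "0 < a'" "a' < t" "0 < b'" "b' < t"
      and "f (x + t *\<^sub>R v + t *\<^sub>R u) - f (x + t *\<^sub>R v) - f (x + t *\<^sub>R u) + f x =
        t * t * ?Q (x + a' *\<^sub>R v + b' *\<^sub>R u)"
      using second_difference_eq[OF t _ f, of x v u] near dist' by blast
    ultimately have "?P (x + a *\<^sub>R u + b *\<^sub>R v) = ?Q (x + a' *\<^sub>R v + b' *\<^sub>R u)"
      using t by (simp add: algebra_simps)
    moreover have "dist (?P (x + a *\<^sub>R u + b *\<^sub>R v)) (?P x) < e/2"
      using near[OF dist[of a b]] ab by auto
    moreover have "dist (?Q (x + a' *\<^sub>R v + b' *\<^sub>R u)) (?Q x) < e/2"
      using near[OF dist'[of a' b']] ab' by auto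
    ultimately show ?thesis unfolding dist_real_def by arith
  qed
  then have "\<bar>?P x - ?Q x\<bar> \<le> 0" by (rule field_le_epsilon[of _ 0, simplified])
  then show ?thesis by simp
qed

section \<open>Bump functions built from exp(-1/t)\<close>

definition flat :: "nat \<Rightarrow> real \<Rightarrow> real" where
  "flat m t = (if t > 0 then exp (- 1 / t) / t ^ m else 0)"

lemma flat_tendsto_0: "(flat m \<longlongrightarrow> 0) (at 0)"
proof -
  have "((\<lambda>t::real. exp (- 1 / t) / t ^ m) \<longlongrightarrow> 0) (at_right 0)"
  proof -
    \<comment> \<open>The substitution s = 1/t reduces the claim to the decay of s^m / exp s at
      infinity.\<close>
    have "((\<lambda>s::real. s ^ m / exp s) \<longlongrightarrow> 0) at_top" by (rule tendsto_power_div_exp_0)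
    then have "((\<lambda>t::real. inverse t ^ m / exp (inverse t)) \<longlongrightarrow> 0) (at_right 0)"
      by (rule filterlim_compose[OF _ filterlim_inverse_at_top_right])
    moreover have "inverse t ^ m / exp (inverse t) = exp (- 1 / t) / t ^ m" for t :: real
      by (simp add: exp_minus field_simps)
    ultimately show ?thesis by simp
  qed
  then have "(flat m \<longlongrightarrow> 0) (at_right 0)"
    by (rule Lim_transform_eventually) (auto simp: flat_def eventually_at_right_less intro!: eventually_mono[OF eventually_at_right_less])
  moreover have "(flat m \<longlongrightarrow> 0) (at_left 0)"
    by (rule Lim_transform_eventually[OF tendsto_const])
      (auto simp: flat_def eventually_at_filter)
  ultimately show ?thesis by (simp add: filterlim_split_at_real)
qed

lemma has_field_derivative_cong_nhds:
  "(f has_field_derivative D) (at x) \<Longrightarrow> \<forall>\<^sub>F s in nhds x. f s = g s \<Longrightarrow>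
    (g has_field_derivative D) (at x)"
  using DERIV_cong_ev[OF refl _ refl] by blast

text \<open>The reason for the index m: differentiation stays within combinations of the
  \<open>flat m\<close>, so one induction for all m at once yields smoothness. At 0 the difference
  quotient of \<open>flat m\<close> is \<open>flat (m + 1)\<close>, which tends to 0.\<close>

lemma flat_has_derivative:
  "(flat m has_field_derivative (flat (m + 2) t - real m * flat (m + 1) t)) (at t)"
proof (cases "t = 0")
  case True
  have "((\<lambda>h. flat m h / h) \<longlongrightarrow> 0) (at 0)"
  proof (rule Lim_transform_eventually[OF flat_tendsto_0[of "m + 1"]])
    show "\<forall>\<^sub>F h in at 0. flat (m + 1) h = flat m h / h" by (auto simp: flat_def eventually_at_filter)
  qed
  then show ?thesis by (simp add: True DERIV_def flat_def)
next
  case False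
  show ?thesis
  proof (cases "t > 0")
    case True
    have "((\<lambda>t::real. exp (- 1 / t) / t ^ m) has_field_derivative (flat (m + 2) t - real m * flat (m + 1) t)) (at t)"
    proof -
      have "((\<lambda>t::real. exp (- 1 / t)) has_field_derivative (exp (- 1 / t) / t\<^sup>2)) (at t)"
        using True by (auto intro!: derivative_eq_intros simp: power2_eq_square)
      from DERIV_divide[OF this DERIV_pow[of m t]]
      have "((\<lambda>t::real. exp (- 1 / t) / t ^ m) has_field_derivative
        (exp (- 1 / t) / t\<^sup>2 * t ^ m - exp (- 1 / t) * (real m * t ^ (m - Suc 0))) / (t ^ m * t ^ m)) (at t)"
        using True by simp
      \<comment> \<open>For m = 0 the exponent is truncated to 0, and the factor
        \<open>real m\<close> makes both sides vanish.\<close>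
      moreover have "real m * t ^ (m - Suc 0) = real m * t ^ m / t"
        using True by (cases m) auto
      ultimately show ?thesis
        using True by (simp add: flat_def diff_divide_distrib power_add power2_eq_square ac_simps)
    qed
    moreover have "\<forall>\<^sub>F s in nhds t. exp (- 1 / s) / s ^ m = flat m s"
      using True eventually_nhds_in_open[of "{0<..}" t] by (auto simp: flat_def elim!: eventually_mono)
    ultimately show ?thesis by (rule has_field_derivative_cong_nhds)
  next
    case neg: False
    then have "t < 0" using False by simp
    have "((\<lambda>s. 0) has_field_derivative (flat (m + 2) t - real m * flat (m + 1) t)) (at t)"
      using \<open>t < 0\<close> by (simp add: flat_def)
    moreover have "\<forall>\<^sub>F s in nhds t. 0 = flat m s"
      using \<open>t < 0\<close> eventually_nhds_in_open[of "{..<0}" t] by (auto simp: flat_def elim!: eventually_mono)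
    ultimately show ?thesis by (rule has_field_derivative_cong_nhds)
  qed
qed

lemma smooth_on_flat: "smooth_on UNIV (flat m)"
proof -
  have "Ck_on k UNIV (flat m)" for k
  proof (induction k arbitrary: m)
    case 0
    have "isCont (flat m) t" for t by (rule DERIV_isCont[OF flat_has_derivative])
    then show ?case by (simp add: continuous_at_imp_continuous_on)
  next
    case (Suc k)
    show ?case
    proof (rule Ck_on_SucI[OF open_UNIV])
      show "(flat m has_derivative (\<lambda>v. (flat (m + 2) t - real m * flat (m + 1) t) * v)) (at t)" for t
        using flat_has_derivative has_field_derivative_def by blast
      fix v :: real
      have "Ck_on k UNIV (\<lambda>t. flat (m + 2) t + (- real m) * flat (m + 1) t)"
        by (intro Ck_on_add Ck_on_linear[OF _ bounded_linear_mult_right] Suc.IH open_UNIV)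
      then show "Ck_on k UNIV (\<lambda>t. (flat (m + 2) t - real m * flat (m + 1) t) * v)"
        by (intro Ck_on_linear[OF _ bounded_linear_mult_left] open_UNIV) simp
    qed
  qed
  then show ?thesis by (simp add: smooth_on_def)
qed

text \<open>\<open>flat 0\<close> is positive exactly on positive arguments; composed with r^2 - |x
  - x0|^2 it vanishes outside the ball, and dividing by its value at the centre normalises
  it.\<close>

lemma smooth_bump_exists:
  fixes x0 :: "'v::euclidean_space"
  assumes "r > 0"
  obtains b :: "'v \<Rightarrow> real" where "smooth_on UNIV b" "b x0 = 1" "\<And>x. x \<notin> cball x0 r \<Longrightarrow> b x = 0"
proof -
  let ?s = "\<lambda>x. r\<^sup>2 - (x - x0) \<bullet> (x - x0)"
  let ?b = "\<lambda>x. inverse (flat 0 (r\<^sup>2)) * flat 0 (?s x)"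
  have 1: "smooth_on UNIV (\<lambda>x. x - x0)"
    using smooth_on_add[OF open_UNIV smooth_on_ident[OF open_UNIV] smooth_on_const[of _ "- x0"]] by simp
  have 2: "smooth_on UNIV ?s"
    using smooth_on_add[OF open_UNIV smooth_on_const[of _ "r\<^sup>2"]
      smooth_on_linear[OF open_UNIV bounded_linear_minus[OF bounded_linear_ident] smooth_on_bilinear[OF open_UNIV bounded_bilinear_inner 1 1]]]
    by simp
  have "smooth_on UNIV ?b"
    by (intro smooth_on_linear[OF open_UNIV bounded_linear_mult_right]
        smooth_on_compose[OF open_UNIV open_UNIV _ smooth_on_flat 2]) simp
  moreover have "?b x0 = 1" using assms by (simp add: flat_def)
  moreover have "?b x = 0" if "x \<notin> cball x0 r" for x
  proof -
    have "r < norm (x - x0)" using that by (simp add: dist_norm norm_minus_commute)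
    then have "r\<^sup>2 < (norm (x - x0))\<^sup>2" using assms by (intro power_strict_mono) auto
    then show ?thesis by (simp add: flat_def power2_norm_eq_inner)
  qed
  ultimately show ?thesis by (rule that)
qed

section \<open>Vector fields on a smooth manifold\<close>

locale smooth_manifold =
  fixes \<A> :: "('a::t2_space, 'n::finite) chart set"
  assumes atlas: "smooth_atlas \<A>"
begin

section \<open>Charts, Jacobians and directional derivatives\<close>

lemma chart_open: "c \<in> \<A> \<Longrightarrow> open (fst c)" "c \<in> \<A> \<Longrightarrow> open (snd c ` fst c)"
  and chart_homeo: "c \<in> \<A> \<Longrightarrow> homeomorphism (fst c) (snd c ` fst c) (snd c) (chart_inv c)"
  and transition_smooth: "c \<in> \<A> \<Longrightarrow> d \<in> \<A> \<Longrightarrow>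
    smooth_on (snd c ` (fst c \<inter> fst d)) (\<lambda>x. snd d (chart_inv c x))"
  using atlas by (auto simp: smooth_atlas_def comp_def)

lemma chart_inv_snd [simp]: "c \<in> \<A> \<Longrightarrow> q \<in> fst c \<Longrightarrow> chart_inv c (snd c q) = q"
  using chart_homeo by (auto simp: homeomorphism_def)

lemma chart_at_mem: "chart_at \<A> p \<in> \<A>" "p \<in> fst (chart_at \<A> p)"
proof -
  have "p \<in> (\<Union>c\<in>\<A>. fst c)" using atlas by (simp add: smooth_atlas_def)
  then have "\<exists>c. c \<in> \<A> \<and> p \<in> fst c" by blast
  then have "chart_at \<A> p \<in> \<A> \<and> p \<in> fst (chart_at \<A> p)" unfolding chart_at_def by (rule someI_ex)
  then show "chart_at \<A> p \<in> \<A>" "p \<in> fst (chart_at \<A> p)" by auto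
qed

lemma open_chart_image:
  assumes "c \<in> \<A>" "open W"
  shows "open (snd c ` (fst c \<inter> W))"
proof -
  have "snd c ` (fst c \<inter> W) = snd c ` fst c \<inter> chart_inv c -` W" using assms(1) by auto
  moreover have "continuous_on (snd c ` fst c) (chart_inv c)"
    using chart_homeo[OF assms(1)] by (auto simp: homeomorphism_def)
  ultimately show ?thesis
    using chart_open(2)[OF assms(1)] assms(2) by (metis continuous_on_open_vimage inf_commute)
qed

text \<open>Both charts are arguments, unlike in \<open>components\<close>, where the source is
  always the chart chosen at the point; this makes the cocycle rule expressible.\<close>

definition jac :: "('a, 'n) chart \<Rightarrow> ('a, 'n) chart \<Rightarrow> 'a \<Rightarrow> real ^ 'n \<Rightarrow> real ^ 'n" where
  "jac c d q = frechet_derivative (\<lambda>x. snd d (chart_inv c x)) (at (snd c q))"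

lemma components_jac: "components \<A> c q = jac (chart_at \<A> q) c q"
  by (simp add: components_def jac_def comp_def fun_eq_iff)

lemma transition_has_derivative:
  assumes "c \<in> \<A>" "d \<in> \<A>" "q \<in> fst c" "q \<in> fst d"
  shows "((\<lambda>x. snd d (chart_inv c x)) has_derivative jac c d q) (at (snd c q))"
  unfolding jac_def
  by (rule smooth_on_has_derivative[OF transition_smooth]) (use assms in auto)

lemma linear_jac:
  "c \<in> \<A> \<Longrightarrow> d \<in> \<A> \<Longrightarrow> q \<in> fst c \<Longrightarrow> q \<in> fst d \<Longrightarrow> linear (jac c d q)"
  using transition_has_derivative has_derivative_linear by blast

lemma has_derivative_change_chart:
  assumes "c \<in> \<A>" "d \<in> \<A>" "q \<in> fst c" "q \<in> fst d"
    and "((\<lambda>x. f (chart_inv d x)) has_derivative f') (at (snd d q))"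
  shows "((\<lambda>x. f (chart_inv c x)) has_derivative (\<lambda>v. f' (jac c d q v))) (at (snd c q))"
proof -
  have "((\<lambda>x. f (chart_inv d x)) has_derivative f') (at (snd d (chart_inv c (snd c q))))"
    using assms by simp
  from has_derivative_compose[OF transition_has_derivative[OF assms(1-4)] this]
  have "((\<lambda>x. f (chart_inv d (snd d (chart_inv c x)))) has_derivative (\<lambda>v. f' (jac c d q v))) (at (snd c q))" .
  then show ?thesis
    by (rule has_derivative_transform_within_open[OF _ open_chart_image[OF assms(1) chart_open(1)[OF assms(2)]]])
      (use assms in auto)
qed

text \<open>Chain rule for transition maps and uniqueness of derivatives. This cocycle rule removes
  the chosen chart \<open>chart_at\<close> from computations.\<close>

lemma jac_jac:
  assumes "c \<in> \<A>" "d \<in> \<A>" "e \<in> \<A>" "q \<in> fst c" "q \<in> fst d" "q \<in> fst e"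
  shows "jac d e q (jac c d q v) = jac c e q v"
  using has_derivative_unique[OF has_derivative_change_chart[where f="snd e", OF assms(1,2,4,5)
      transition_has_derivative[OF assms(2,3,5,6)]] transition_has_derivative[OF assms(1,3,4,6)]]
  by (simp add: fun_eq_iff)

lemma jac_same:
  assumes "c \<in> \<A>" "q \<in> fst c"
  shows "jac c c q v = v"
proof -
  have "((\<lambda>x. x) has_derivative jac c c q) (at (snd c q))"
    by (rule has_derivative_transform_within_open[OF transition_has_derivative[OF assms(1,1,2,2)]
          chart_open(2)[OF assms(1)]]) (use assms in auto)
  from has_derivative_unique[OF this has_derivative_ident] show ?thesis by (simp add: fun_eq_iff)
qed

lemma chart_rep_at: "c \<in> \<A> \<Longrightarrow> q \<in> fst c \<Longrightarrow> chart_rep \<A> c X (snd c q) = jac (chart_at \<A> q) c q (X q)"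
  by (simp add: chart_rep_def components_jac)

lemma chart_rep_chart_at: "chart_rep \<A> (chart_at \<A> p) X (snd (chart_at \<A> p) p) = X p"
  by (simp add: chart_rep_at chart_at_mem jac_same)

lemma smooth_funD: "smooth_fun \<A> f \<Longrightarrow> c \<in> \<A> \<Longrightarrow> smooth_on (snd c ` fst c) (\<lambda>x. f (chart_inv c x))"
  by (simp add: smooth_fun_def comp_def)

lemma smooth_vfieldD: "smooth_vfield \<A> X \<Longrightarrow> c \<in> \<A> \<Longrightarrow> smooth_on (snd c ` fst c) (chart_rep \<A> c X)"
  by (simp add: smooth_vfield_def)

lemma smooth_fun_has_derivative:
  assumes "smooth_fun \<A> f" "c \<in> \<A>" "q \<in> fst c"
  shows "((\<lambda>x. f (chart_inv c x)) has_derivative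
    frechet_derivative (\<lambda>x. f (chart_inv c x)) (at (snd c q))) (at (snd c q))"
  by (rule smooth_on_has_derivative[OF smooth_funD]) (use assms in auto)

text \<open>\<open>vderiv\<close> at q uses the chart chosen at q, which may jump as q moves; in one
  fixed chart the function X f can be differentiated again.\<close>

lemma vderiv_in_chart:
  assumes "smooth_fun \<A> f" "c \<in> \<A>" "q \<in> fst c"
  shows "vderiv \<A> X f q =
    frechet_derivative (\<lambda>x. f (chart_inv c x)) (at (snd c q)) (chart_rep \<A> c X (snd c q))"
proof -
  let ?d = "chart_at \<A> q"
  have "((\<lambda>x. f (chart_inv ?d x)) has_derivative
    (\<lambda>v. frechet_derivative (\<lambda>x. f (chart_inv c x)) (at (snd c q)) (jac ?d c q v))) (at (snd ?d q))"
    by (rule has_derivative_change_chart[OF _ _ _ _ smooth_fun_has_derivative]) (use assms chart_at_mem in auto)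
  from frechet_derivative_at[OF this] show ?thesis
    by (simp add: vderiv_def chart_rep_at assms comp_def fun_eq_iff)
qed

lemma vderiv_linear:
  assumes "smooth_fun \<A> f"
  shows "vderiv \<A> (\<lambda>q. X q + Y q) f p = vderiv \<A> X f p + vderiv \<A> Y f p"
    "vderiv \<A> (\<lambda>q. X q - Y q) f p = vderiv \<A> X f p - vderiv \<A> Y f p"
    "vderiv \<A> (\<lambda>q. h q *\<^sub>R X q) f p = h p * vderiv \<A> X f p"
  using has_derivative_linear[OF smooth_fun_has_derivative[OF assms chart_at_mem]]
  by (auto simp: vderiv_def comp_def linear_add linear_diff linear_cmul)

lemma smooth_fun_const: "smooth_fun \<A> (\<lambda>q. k)"
  by (simp add: smooth_fun_def comp_def smooth_on_const)

lemma smooth_fun_add: "smooth_fun \<A> f \<Longrightarrow> smooth_fun \<A> h \<Longrightarrow> smooth_fun \<A> (\<lambda>q. f q + h q)"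
  by (auto simp: smooth_fun_def comp_def intro!: smooth_on_add chart_open)

lemma smooth_fun_mult: "smooth_fun \<A> f \<Longrightarrow> smooth_fun \<A> h \<Longrightarrow> smooth_fun \<A> (\<lambda>q. f q * h q)"
  by (auto simp: smooth_fun_def comp_def intro!: smooth_on_bilinear[OF _ bounded_bilinear_mult] chart_open)

lemma smooth_fun_minus: "smooth_fun \<A> f \<Longrightarrow> smooth_fun \<A> (\<lambda>q. - f q)"
  using smooth_fun_mult[OF smooth_fun_const[of "-1"]] by simp

lemma smooth_fun_diff: "smooth_fun \<A> f \<Longrightarrow> smooth_fun \<A> h \<Longrightarrow> smooth_fun \<A> (\<lambda>q. f q - h q)"
  using smooth_fun_add[OF _ smooth_fun_minus] by fastforce

lemma vderiv_diff:
  assumes "smooth_fun \<A> f" "smooth_fun \<A> h"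
  shows "vderiv \<A> X (\<lambda>q. f q - h q) p = vderiv \<A> X f p - vderiv \<A> X h p"
    and vderiv_add: "vderiv \<A> X (\<lambda>q. f q + h q) p = vderiv \<A> X f p + vderiv \<A> X h p"
  using frechet_derivative_at[OF has_derivative_diff[OF smooth_fun_has_derivative[OF assms(1) chart_at_mem]
      smooth_fun_has_derivative[OF assms(2) chart_at_mem]]]
    frechet_derivative_at[OF has_derivative_add[OF smooth_fun_has_derivative[OF assms(1) chart_at_mem]
      smooth_fun_has_derivative[OF assms(2) chart_at_mem]]]
  by (simp_all add: vderiv_def comp_def fun_eq_iff)

lemma vderiv_mult:
  assumes "smooth_fun \<A> f" "smooth_fun \<A> h"
  shows "vderiv \<A> X (\<lambda>q. f q * h q) p = f p * vderiv \<A> X h p + vderiv \<A> X f p * h p"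
  using frechet_derivative_at[OF has_derivative_mult[OF smooth_fun_has_derivative[OF assms(1) chart_at_mem]
      smooth_fun_has_derivative[OF assms(2) chart_at_mem]]]
  by (simp add: vderiv_def comp_def fun_eq_iff chart_at_mem)

lemma smooth_vfield_add:
  assumes "smooth_vfield \<A> X" "smooth_vfield \<A> Y"
  shows "smooth_vfield \<A> (\<lambda>q. X q + Y q)"
  unfolding smooth_vfield_def
proof
  fix c assume c: "c \<in> \<A>"
  show "smooth_on (snd c ` fst c) (chart_rep \<A> c (\<lambda>q. X q + Y q))"
    by (subst smooth_on_cong[OF chart_open(2)[OF c], where g = "\<lambda>x. chart_rep \<A> c X x + chart_rep \<A> c Y x"])
      (auto simp: chart_rep_at c linear_add[OF linear_jac] chart_at_mem
        intro!: smooth_on_add chart_open smooth_vfieldD assms)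
qed

lemma smooth_vfield_scaleR:
  assumes "smooth_fun \<A> f" "smooth_vfield \<A> X"
  shows "smooth_vfield \<A> (\<lambda>q. f q *\<^sub>R X q)"
  unfolding smooth_vfield_def
proof
  fix c assume c: "c \<in> \<A>"
  show "smooth_on (snd c ` fst c) (chart_rep \<A> c (\<lambda>q. f q *\<^sub>R X q))"
    by (subst smooth_on_cong[OF chart_open(2)[OF c], where g = "\<lambda>x. f (chart_inv c x) *\<^sub>R chart_rep \<A> c X x"])
      (auto simp: chart_rep_at c linear_cmul[OF linear_jac] chart_at_mem
        intro!: smooth_on_scaleR chart_open smooth_vfieldD smooth_funD assms)
qed

lemma smooth_vfield_minus: "smooth_vfield \<A> X \<Longrightarrow> smooth_vfield \<A> (\<lambda>q. - X q)"
  using smooth_vfield_scaleR[OF smooth_fun_const[of "-1"]] by simp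

lemma smooth_vfield_diff:
  "smooth_vfield \<A> X \<Longrightarrow> smooth_vfield \<A> Y \<Longrightarrow> smooth_vfield \<A> (\<lambda>q. X q - Y q)"
  using smooth_vfield_add[OF _ smooth_vfield_minus] by fastforce

lemma smooth_fun_vderiv:
  assumes "smooth_fun \<A> f" "smooth_vfield \<A> X"
  shows "smooth_fun \<A> (vderiv \<A> X f)"
  unfolding smooth_fun_def comp_def
proof
  fix c assume c: "c \<in> \<A>"
  show "smooth_on (snd c ` fst c) (\<lambda>x. vderiv \<A> X f (chart_inv c x))"
    by (subst smooth_on_cong[OF chart_open(2)[OF c], where
          g = "\<lambda>x. frechet_derivative (\<lambda>x. f (chart_inv c x)) (at x) (chart_rep \<A> c X x)"])
      (auto simp: c vderiv_in_chart assms(1)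
        intro!: smooth_on_deriv_apply chart_open smooth_vfieldD smooth_funD assms)
qed

text \<open>A product rule: differentiate F' with the direction frozen at \<open>X x\<close>, then
  differentiate the direction.\<close>

lemma has_derivative_deriv_apply:
  fixes F :: "real ^ 'n \<Rightarrow> real"
  assumes "open S" "x \<in> S" "smooth_on S F" "smooth_on S X"
  shows "((\<lambda>y. frechet_derivative F (at y) (X y)) has_derivative
    (\<lambda>v. frechet_derivative (\<lambda>y. frechet_derivative F (at y) (X x)) (at x) v +
      frechet_derivative F (at x) (frechet_derivative X (at x) v))) (at x)"
proof -
  note F = smooth_on_differentiable[OF assms(3)]
  let ?X' = "frechet_derivative X (at x)"
  let ?F' = "\<lambda>b. frechet_derivative (\<lambda>y. frechet_derivative F (at y) b) (at x)"
  have D: "((\<lambda>y. frechet_derivative F (at y) b) has_derivative ?F' b) (at x)" for b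
    by (rule smooth_on_has_derivative[OF smooth_on_deriv]) (use assms in auto)
  have "((\<lambda>y. \<Sum>b\<in>Basis. (X y \<bullet> b) * frechet_derivative F (at y) b) has_derivative
    (\<lambda>v. \<Sum>b\<in>Basis. (X x \<bullet> b) * ?F' b v + (?X' v \<bullet> b) * frechet_derivative F (at x) b)) (at x)"
    by (intro has_derivative_sum has_derivative_mult has_derivative_inner_left D
        smooth_on_has_derivative[OF assms(4,2)])
  \<comment> \<open>Freezing the coefficients at x in the basis expansion identifies the first part
    of the sum, by uniqueness of the derivative, with the second derivative in the fixed direction
    \<open>X x\<close>.\<close>
  moreover have "(\<Sum>b\<in>Basis. (X x \<bullet> b) * ?F' b v + (?X' v \<bullet> b) * frechet_derivative F (at x) b) =
    ?F' (X x) v + frechet_derivative F (at x) (?X' v)" for v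
  proof -
    have "((\<lambda>y. \<Sum>b\<in>Basis. (X x \<bullet> b) * frechet_derivative F (at y) b) has_derivative
      (\<lambda>v. \<Sum>b\<in>Basis. (X x \<bullet> b) * ?F' b v)) (at x)"
      by (intro has_derivative_sum has_derivative_mult_right D)
    then have "((\<lambda>y. frechet_derivative F (at y) (X x)) has_derivative
      (\<lambda>v. \<Sum>b\<in>Basis. (X x \<bullet> b) * ?F' b v)) (at x)"
      by (rule has_derivative_transform_within_open[OF _ assms(1,2)])
        (simp add: linear_euclidean_expand[OF linear_frechet_derivative[OF F], of _ "X x"])
    from frechet_derivative_at[OF this]
    have "?F' (X x) v = (\<Sum>b\<in>Basis. (X x \<bullet> b) * ?F' b v)" by (simp add: fun_eq_iff)
    then show ?thesis
      using linear_euclidean_expand[OF linear_frechet_derivative[OF F[OF assms(2)]], of "?X' v"]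
      by (simp add: sum.distrib)
  qed
  ultimately have "((\<lambda>y. \<Sum>b\<in>Basis. (X y \<bullet> b) * frechet_derivative F (at y) b) has_derivative
    (\<lambda>v. ?F' (X x) v + frechet_derivative F (at x) (?X' v))) (at x)" by simp
  then show ?thesis
    by (rule has_derivative_transform_within_open[OF _ assms(1,2)])
      (simp add: linear_euclidean_expand[OF linear_frechet_derivative[OF F]])
qed

lemma vderiv_vderiv:
  fixes p
  assumes f: "smooth_fun \<A> f" and Y: "smooth_vfield \<A> Y"
  defines "c \<equiv> chart_at \<A> p"
  defines "F \<equiv> \<lambda>x. f (chart_inv c x)"
  shows "vderiv \<A> X (vderiv \<A> Y f) p =
    frechet_derivative (\<lambda>y. frechet_derivative F (at y) (Y p)) (at (snd c p)) (X p) +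
    frechet_derivative F (at (snd c p)) (frechet_derivative (chart_rep \<A> c Y) (at (snd c p)) (X p))"
proof -
  note c = chart_at_mem[of p, folded c_def]
  have "((\<lambda>x. frechet_derivative F (at x) (chart_rep \<A> c Y x)) has_derivative
    (\<lambda>v. frechet_derivative (\<lambda>y. frechet_derivative F (at y) (Y p)) (at (snd c p)) v +
      frechet_derivative F (at (snd c p)) (frechet_derivative (chart_rep \<A> c Y) (at (snd c p)) v))) (at (snd c p))"
    using has_derivative_deriv_apply[OF chart_open(2)[OF c(1)] _ smooth_funD[OF f c(1)] smooth_vfieldD[OF Y c(1)], of "snd c p"]
      chart_rep_chart_at[of p Y, folded c_def] c(2) by (simp add: F_def)
  then have "((\<lambda>x. vderiv \<A> Y f (chart_inv c x)) has_derivative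
    (\<lambda>v. frechet_derivative (\<lambda>y. frechet_derivative F (at y) (Y p)) (at (snd c p)) v +
      frechet_derivative F (at (snd c p)) (frechet_derivative (chart_rep \<A> c Y) (at (snd c p)) v))) (at (snd c p))"
    by (rule has_derivative_transform_within_open[OF _ chart_open(2)[OF c(1)]])
      (use c in \<open>auto simp: F_def vderiv_in_chart[OF f]\<close>)
  from frechet_derivative_at[OF this] show ?thesis
    by (simp add: vderiv_def comp_def fun_eq_iff flip: c_def)
qed

text \<open>In a chart the second-order terms of X(Yf) - Y(Xf) cancel by symmetry of the second
  derivative; the first-order terms are F' applied to the components of the bracket.\<close>

lemma vderiv_lie_bracket:
  assumes f: "smooth_fun \<A> f" and X: "smooth_vfield \<A> X" and Y: "smooth_vfield \<A> Y"
  shows "vderiv \<A> (lie_bracket \<A> X Y) f p = vderiv \<A> X (vderiv \<A> Y f) p - vderiv \<A> Y (vderiv \<A> X f) p"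
proof -
  define c where "c = chart_at \<A> p"
  define F where "F = (\<lambda>x. f (chart_inv c x))"
  note c = chart_at_mem[of p, folded c_def]
  have sm: "smooth_on (snd c ` fst c) F" using smooth_funD[OF f c(1)] by (simp add: F_def)
  then have "Ck_on 2 (snd c ` fst c) F" by (simp add: smooth_on_def)
  from second_derivative_symmetric[OF chart_open(2)[OF c(1)] _ this]
  have "frechet_derivative (\<lambda>y. frechet_derivative F (at y) (Y p)) (at (snd c p)) (X p) =
    frechet_derivative (\<lambda>y. frechet_derivative F (at y) (X p)) (at (snd c p)) (Y p)"
    using c(2) by blast
  then show ?thesis
    using linear_diff[OF linear_frechet_derivative[OF smooth_on_differentiable[OF sm]]] c
    by (simp add: vderiv_vderiv[OF f Y] vderiv_vderiv[OF f X] flip: c_def F_def)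
      (simp add: vderiv_def lie_bracket_def Let_def comp_def flip: c_def F_def)
qed

section \<open>Extension by zero and local frames\<close>

definition extend_fun :: "('a, 'n) chart \<Rightarrow> (real ^ 'n \<Rightarrow> real) \<Rightarrow> 'a \<Rightarrow> real" where
  "extend_fun c h q = (if q \<in> fst c then h (snd c q) else 0)"

text \<open>\<open>h\<close> gives components in the chart c; \<open>jac\<close> converts them at
  each q to the chart chosen at q, in which vector fields are stored.\<close>

definition extend_vfield :: "('a, 'n) chart \<Rightarrow> (real ^ 'n \<Rightarrow> real ^ 'n) \<Rightarrow> ('a, 'n) vfield" where
  "extend_vfield c h q = (if q \<in> fst c then jac c (chart_at \<A> q) q (h (snd c q)) else 0)"

text \<open>The part of the manifold corresponding to K is compact, hence closed in a Hausdorff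
  space. So F vanishes near every point outside the domain of c, and on the overlap it is smooth by
  assumption.\<close>

lemma smooth_on_chart_extension:
  fixes F :: "real ^ 'n \<Rightarrow> 'w::real_normed_vector"
  assumes c: "c \<in> \<A>" and d: "d \<in> \<A>" and K: "compact K" "K \<subseteq> snd c ` fst c"
    and sm: "smooth_on (snd d ` (fst d \<inter> fst c)) F"
    and zero: "\<And>q. q \<in> fst d \<Longrightarrow> (q \<in> fst c \<Longrightarrow> snd c q \<notin> K) \<Longrightarrow> F (snd d q) = 0"
  shows "smooth_on (snd d ` fst d) F"
proof (rule smooth_on_local)
  fix x assume "x \<in> snd d ` fst d"
  then obtain q where q: "q \<in> fst d" "x = snd d q" by auto
  have "continuous_on K (chart_inv c)"
    using chart_homeo[OF c] K(2) continuous_on_subset by (auto simp: homeomorphism_def)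
  then have closed: "closed (chart_inv c ` K)"
    using K(1) compact_continuous_image compact_imp_closed by blast
  have sub: "chart_inv c ` K \<subseteq> fst c" using K(2) c by auto
  show "\<exists>U. open U \<and> x \<in> U \<and> smooth_on U F"
  proof (cases "q \<in> fst c")
    case True
    then show ?thesis using open_chart_image[OF d chart_open(1)[OF c]] sm q by blast
  next
    case False
    let ?U = "snd d ` (fst d \<inter> - chart_inv c ` K)"
    have "open ?U" by (intro open_chart_image d) (use closed in auto)
    moreover have "x \<in> ?U" using False sub q by blast
    moreover have "F y = 0" if "y \<in> ?U" for y
    proof -
      from that obtain q' where q': "q' \<in> fst d" "q' \<notin> chart_inv c ` K" "y = snd d q'" by auto
      have "snd c q' \<notin> K" if "q' \<in> fst c" using q'(2) c that by force
      then show ?thesis using zero q' by blast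
    qed
    then have "smooth_on ?U F"
      using smooth_on_cong[OF \<open>open ?U\<close>, of F "\<lambda>_. 0"] smooth_on_const by auto
    ultimately show ?thesis by blast
  qed
qed

lemma smooth_extend_fun:
  assumes c: "c \<in> \<A>" and K: "compact K" "K \<subseteq> snd c ` fst c"
    and h: "smooth_on (snd c ` fst c) h" "\<And>x. x \<notin> K \<Longrightarrow> h x = 0"
  shows "smooth_fun \<A> (extend_fun c h)"
  unfolding smooth_fun_def comp_def
proof
  fix d assume d: "d \<in> \<A>"
  have op: "open (snd d ` (fst d \<inter> fst c))" by (intro open_chart_image d chart_open c)
  show "smooth_on (snd d ` fst d) (\<lambda>x. extend_fun c h (chart_inv d x))"
  proof (rule smooth_on_chart_extension[OF c d K])
    have "smooth_on (snd d ` (fst d \<inter> fst c)) (\<lambda>x. h (snd c (chart_inv d x)))"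
      by (rule smooth_on_compose[OF op chart_open(2)[OF c] _ h(1) transition_smooth[OF d c]]) (use c d in auto)
    then show "smooth_on (snd d ` (fst d \<inter> fst c)) (\<lambda>x. extend_fun c h (chart_inv d x))"
      by (subst smooth_on_cong[OF op]) (auto simp: extend_fun_def d)
  qed (use d h in \<open>auto simp: extend_fun_def\<close>)
qed

lemma smooth_extend_vfield:
  assumes c: "c \<in> \<A>" and K: "compact K" "K \<subseteq> snd c ` fst c"
    and h: "smooth_on (snd c ` fst c) h" "\<And>x. x \<notin> K \<Longrightarrow> h x = 0"
  shows "smooth_vfield \<A> (extend_vfield c h)"
  unfolding smooth_vfield_def
proof
  fix d assume d: "d \<in> \<A>"
  have op: "open (snd d ` (fst d \<inter> fst c))" "open (snd c ` (fst c \<inter> fst d))"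
    by (intro open_chart_image d chart_open c)+
  let ?G = "\<lambda>y. frechet_derivative (\<lambda>x. snd d (chart_inv c x)) (at y) (h y)"
  \<comment> \<open>The cocycle rule cancels the chart chosen at q; what remains is the Jacobian of
    a transition map applied to h, which is smooth on the overlap.\<close>
  have rep: "chart_rep \<A> d (extend_vfield c h) (snd d q) = ?G (snd c q)" if "q \<in> fst d" "q \<in> fst c" for q
    using that c d by (simp add: chart_rep_at extend_vfield_def jac_jac chart_at_mem) (simp add: jac_def)
  show "smooth_on (snd d ` fst d) (chart_rep \<A> d (extend_vfield c h))"
  proof (rule smooth_on_chart_extension[OF c d K])
    have G: "smooth_on (snd c ` (fst c \<inter> fst d)) ?G"
      by (intro smooth_on_deriv_apply op transition_smooth c d smooth_on_subset[OF h(1)]) auto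
    have "smooth_on (snd d ` (fst d \<inter> fst c)) (\<lambda>x. ?G (snd c (chart_inv d x)))"
      by (rule smooth_on_compose[OF op _ G transition_smooth[OF d c]]) (use c d in auto)
    then show "smooth_on (snd d ` (fst d \<inter> fst c)) (chart_rep \<A> d (extend_vfield c h))"
      by (subst smooth_on_cong[OF op(1)]) (auto simp: rep d)
  next
    fix q assume q: "q \<in> fst d" "q \<in> fst c \<Longrightarrow> snd c q \<notin> K"
    then have "extend_vfield c h q = 0"
      using h(2) c by (auto simp: extend_vfield_def linear_0[OF linear_jac] chart_at_mem)
    then show "chart_rep \<A> d (extend_vfield c h) (snd d q) = 0"
      using q d by (simp add: chart_rep_at linear_0[OF linear_jac] chart_at_mem)
  qed
qed

lemma bump_at:
  obtains b K where "compact K" "K \<subseteq> snd (chart_at \<A> p) ` fst (chart_at \<A> p)" "smooth_on UNIV b"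
    "b (snd (chart_at \<A> p) p) = (1::real)" "\<And>x. x \<notin> K \<Longrightarrow> b x = 0"
proof -
  let ?c = "chart_at \<A> p"
  have "snd ?c p \<in> snd ?c ` fst ?c" using chart_at_mem by blast
  then obtain r where r: "r > 0" "cball (snd ?c p) r \<subseteq> snd ?c ` fst ?c"
    using chart_open(2)[OF chart_at_mem(1)] open_contains_cball by metis
  from smooth_bump_exists[OF r(1)] show ?thesis
    using that[OF compact_cball r(2)] by metis
qed

text \<open>Neither the coordinate fields nor the components of V are defined globally, so each is
  multiplied by a bump function; their product therefore recovers V only up to its square.\<close>

lemma local_frame:
  obtains E :: "'n \<Rightarrow> ('a, 'n) vfield" and \<phi> :: "'a \<Rightarrow> real" where
    "smooth_fun \<A> \<phi>" "\<phi> p = 1" "\<And>i. smooth_vfield \<A> (E i)" "\<And>i. E i p = axis i 1"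
    "\<And>V. smooth_vfield \<A> V \<Longrightarrow> \<exists>f. (\<forall>i. smooth_fun \<A> (f i) \<and> f i p = V p $ i) \<and>
        (\<forall>q. (\<phi> q * \<phi> q) *\<^sub>R V q = (\<Sum>i\<in>UNIV. f i q *\<^sub>R E i q))"
proof -
  let ?c = "chart_at \<A> p"
  note c = chart_at_mem[of p]
  obtain b K where K: "compact K" "K \<subseteq> snd ?c ` fst ?c" and b: "smooth_on UNIV b"
    "b (snd ?c p) = (1::real)" "\<And>x. x \<notin> K \<Longrightarrow> b x = 0" by (rule bump_at[of p]) blast
  have bc: "smooth_on (snd ?c ` fst ?c) b" by (rule smooth_on_subset[OF b(1)]) auto
  define E where "E i = extend_vfield ?c (\<lambda>x. b x *\<^sub>R axis i 1)" for i
  define \<phi> where "\<phi> = extend_fun ?c b"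
  show ?thesis
  proof (rule that[of \<phi> E])
    show "smooth_fun \<A> \<phi>" unfolding \<phi>_def by (rule smooth_extend_fun[OF c(1) K bc b(3)])
    show "\<phi> p = 1" using b c by (simp add: \<phi>_def extend_fun_def)
    show "smooth_vfield \<A> (E i)" for i
      unfolding E_def
      by (rule smooth_extend_vfield[OF c(1) K])
        (use bc b(3) in \<open>auto intro!: smooth_on_scaleR smooth_on_const chart_open c\<close>)
    show "E i p = axis i 1" for i
      using b c by (simp add: E_def extend_vfield_def jac_same)
    fix V assume V: "smooth_vfield \<A> V"
    define f where "f i = extend_fun ?c (\<lambda>x. b x * (chart_rep \<A> ?c V x $ i))" for i
    have "smooth_fun \<A> (f i)" for i
      unfolding f_def
      by (rule smooth_extend_fun[OF c(1) K])
        (use bc b(3) V c in \<open>auto intro!: smooth_on_bilinear[OF _ bounded_bilinear_mult] chart_open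
            smooth_on_linear[OF _ bounded_linear_vec_nth] smooth_vfieldD\<close>)
    moreover have "f i p = V p $ i" for i
      using b c by (simp add: f_def extend_fun_def chart_rep_chart_at)
    moreover have "(\<phi> q * \<phi> q) *\<^sub>R V q = (\<Sum>i\<in>UNIV. f i q *\<^sub>R E i q)" for q
    proof (cases "q \<in> fst ?c")
      case True
      let ?x = "snd ?c q" and ?d = "chart_at \<A> q"
      let ?W = "chart_rep \<A> ?c V ?x"
      have lin: "linear (jac ?c ?d q)" using True c chart_at_mem linear_jac by blast
      have "(\<Sum>i\<in>UNIV. f i q *\<^sub>R E i q) = (\<Sum>i\<in>UNIV. (b ?x * b ?x) *\<^sub>R ((?W $ i) *\<^sub>R jac ?c ?d q (axis i 1)))"
        using True by (simp add: f_def E_def extend_fun_def extend_vfield_def linear_cmul[OF lin] ac_simps)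
      also have "\<dots> = (b ?x * b ?x) *\<^sub>R jac ?c ?d q (\<Sum>i\<in>UNIV. (?W $ i) *\<^sub>R axis i 1)"
        by (simp add: linear_sum[OF lin] linear_cmul[OF lin] scaleR_sum_right)
      also have "(\<Sum>i\<in>UNIV. (?W $ i) *\<^sub>R axis i 1) = ?W"
        by (simp add: basis_expansion scalar_mult_eq_scaleR[symmetric])
      also have "jac ?c ?d q ?W = V q"
        using True c chart_at_mem by (simp add: chart_rep_at jac_jac jac_same)
      finally show ?thesis using True by (simp add: \<phi>_def extend_fun_def)
    qed (simp add: \<phi>_def f_def extend_fun_def)
    ultimately show "\<exists>f. (\<forall>i. smooth_fun \<A> (f i) \<and> f i p = V p $ i) \<and>
        (\<forall>q. (\<phi> q * \<phi> q) *\<^sub>R V q = (\<Sum>i\<in>UNIV. f i q *\<^sub>R E i q))" by blast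
  qed
qed

text \<open>The test functions are coordinates times a bump b: W(b x_i) = W_i + x_i(p) W(b), as b =
  1 at p, and W(b) = 0 by the same hypothesis.\<close>

lemma vector_eq_0_if_vderiv_eq_0:
  assumes "\<And>f. smooth_fun \<A> f \<Longrightarrow> vderiv \<A> W f p = 0"
  shows "W p = 0"
proof -
  let ?c = "chart_at \<A> p" and ?D = "\<lambda>F. frechet_derivative F (at (snd (chart_at \<A> p) p)) (W p)"
  note c = chart_at_mem[of p]
  obtain b K where K: "compact K" "K \<subseteq> snd ?c ` fst ?c" and b: "smooth_on UNIV b"
    "b (snd ?c p) = (1::real)" "\<And>x. x \<notin> K \<Longrightarrow> b x = 0" by (rule bump_at[of p]) blast
  have bc: "smooth_on (snd ?c ` fst ?c) b" by (rule smooth_on_subset[OF b(1)]) auto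
  have D0: "?D h = 0" if h: "smooth_on (snd ?c ` fst ?c) h" "\<And>x. x \<notin> K \<Longrightarrow> h x = 0" for h :: "real ^ 'n \<Rightarrow> real"
  proof -
    have sm: "smooth_fun \<A> (extend_fun ?c h)" by (rule smooth_extend_fun[OF c(1) K h])
    have "?D h = ?D (\<lambda>x. extend_fun ?c h (chart_inv ?c x))"
      by (subst frechet_derivative_transform_within_open[OF smooth_on_differentiable[OF h(1)] chart_open(2)[OF c(1)]])
        (use c in \<open>auto simp: extend_fun_def\<close>)
    also have "\<dots> = 0" using assms[OF sm] by (simp add: vderiv_def comp_def)
    finally show ?thesis .
  qed
  have "W p $ i = 0" for i
  proof -
    have db: "(b has_derivative frechet_derivative b (at (snd ?c p))) (at (snd ?c p))"
      by (rule smooth_on_has_derivative[OF b(1)]) simp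
    have "((\<lambda>x. b x * (x $ i)) has_derivative
      (\<lambda>v. b (snd ?c p) * (v $ i) + frechet_derivative b (at (snd ?c p)) v * (snd ?c p $ i))) (at (snd ?c p))"
      by (intro has_derivative_mult db bounded_linear.has_derivative[OF bounded_linear_vec_nth] has_derivative_ident)
    from frechet_derivative_at[OF this]
    have "?D (\<lambda>x. b x * (x $ i)) = W p $ i + ?D b * (snd ?c p $ i)" using b(2) by (simp add: fun_eq_iff)
    moreover have "?D (\<lambda>x. b x * (x $ i)) = 0"
      by (rule D0) (use b(3) in \<open>auto intro!: smooth_on_bilinear[OF _ bounded_bilinear_mult] bc chart_open c
          smooth_on_linear[OF _ bounded_linear_vec_nth] smooth_on_ident\<close>)
    moreover have "?D b = 0" by (rule D0[OF bc b(3)])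
    ultimately show ?thesis by simp
  qed
  then show ?thesis by (simp add: vec_eq_iff)
qed

end

section \<open>Tensoriality and curvature\<close>

context smooth_manifold
begin

text \<open>The value type is left open because curvature takes values in vectors and
  \<open>nab_form\<close> in the reals.\<close>

definition tensorial_at :: "'a \<Rightarrow> (('a, 'n) vfield \<Rightarrow> 'w::real_vector) \<Rightarrow> bool" where
  "tensorial_at p T \<longleftrightarrow>
     (\<forall>X Y. smooth_vfield \<A> X \<longrightarrow> smooth_vfield \<A> Y \<longrightarrow> T (\<lambda>q. X q + Y q) = T X + T Y) \<and>
     (\<forall>f X. smooth_fun \<A> f \<longrightarrow> smooth_vfield \<A> X \<longrightarrow> T (\<lambda>q. f q *\<^sub>R X q) = f p *\<^sub>R T X)"

lemma tensorial_atI: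
  assumes "\<And>X Y. smooth_vfield \<A> X \<Longrightarrow> smooth_vfield \<A> Y \<Longrightarrow> T (\<lambda>q. X q + Y q) = T X + T Y"
    and "\<And>f X. smooth_fun \<A> f \<Longrightarrow> smooth_vfield \<A> X \<Longrightarrow> T (\<lambda>q. f q *\<^sub>R X q) = f p *\<^sub>R T X"
  shows "tensorial_at p T"
  using assms by (auto simp: tensorial_at_def)

lemma tensorial_at_sum:
  assumes T: "tensorial_at p T" and I: "finite I" "I \<noteq> {}"
    and f: "\<And>i. i \<in> I \<Longrightarrow> smooth_fun \<A> (f i)" and E: "\<And>i. i \<in> I \<Longrightarrow> smooth_vfield \<A> (E i)"
  shows "smooth_vfield \<A> (\<lambda>q. \<Sum>i\<in>I. f i q *\<^sub>R E i q) \<and>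
    T (\<lambda>q. \<Sum>i\<in>I. f i q *\<^sub>R E i q) = (\<Sum>i\<in>I. f i p *\<^sub>R T (E i))"
  using I f E
proof (induction I rule: finite_ne_induct)
  case (singleton i)
  then show ?case using T by (simp add: tensorial_at_def smooth_vfield_scaleR)
next
  case (insert i I)
  then have "smooth_vfield \<A> (\<lambda>q. f i q *\<^sub>R E i q)" by (simp add: smooth_vfield_scaleR)
  with insert T show ?case by (simp add: tensorial_at_def smooth_vfield_add)
qed

text \<open>Justifies the choice behind \<open>extend_vector\<close>: the combination of frame
  fields with constant coefficients is globally smooth and has the value v at p.\<close>

lemma extend_vector: "smooth_vfield \<A> (extend_vector \<A> p v)" "extend_vector \<A> p v p = v"
proof -
  obtain E where E: "\<And>i. smooth_vfield \<A> (E i)" "\<And>i. E i p = axis i (1::real)"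
    by (rule local_frame[of p]) (rule that)
  let ?V = "\<lambda>q. \<Sum>i\<in>UNIV. (v $ i) *\<^sub>R E i q"
  \<comment> \<open>Only the smoothness half of \<open>tensorial_at_sum\<close> is wanted, so it is
    applied to the zero operator.\<close>
  have "tensorial_at p (\<lambda>_. 0::real)" by (simp add: tensorial_at_def)
  from tensorial_at_sum[OF this finite UNIV_not_empty, of "\<lambda>i _. v $ i" E]
  have "smooth_vfield \<A> ?V" by (simp add: E smooth_fun_const)
  moreover have "?V p = v"
    by (simp add: E basis_expansion scalar_mult_eq_scaleR[symmetric])
  ultimately have "smooth_vfield \<A> (extend_vector \<A> p v) \<and> extend_vector \<A> p v p = v"
    unfolding extend_vector_def
    using someI[of "\<lambda>V. smooth_vfield \<A> V \<and> V p = v" ?V] by blast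
  then show "smooth_vfield \<A> (extend_vector \<A> p v)" "extend_vector \<A> p v p = v" by auto
qed

text \<open>For the frame \<open>E\<close>, \<open>\<phi>\<close> of \<open>local_frame\<close>, a tensorial operator takes the same value at \<open>V\<close>
  and at \<open>\<phi>\<^sup>2 V\<close>, which is a combination of the globally defined fields \<open>E i\<close>.\<close>

lemma tensorial_at_eq:
  assumes T: "tensorial_at p T" and VW: "smooth_vfield \<A> V" "smooth_vfield \<A> W" "V p = W p"
  shows "T V = T W"
proof -
  obtain E and \<phi> :: "'a \<Rightarrow> real" where \<phi>: "smooth_fun \<A> \<phi>" "\<phi> p = 1"
    and E: "\<And>i. smooth_vfield \<A> (E i)"
    and ex: "\<And>V. smooth_vfield \<A> V \<Longrightarrow> \<exists>f. (\<forall>i. smooth_fun \<A> (f i) \<and> f i p = V p $ i) \<and>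
        (\<forall>q. (\<phi> q * \<phi> q) *\<^sub>R V q = (\<Sum>i\<in>UNIV. f i q *\<^sub>R E i q))"
    by (rule local_frame[of p]) (rule that)
  have "T V = (\<Sum>i\<in>UNIV. (V p $ i) *\<^sub>R T (E i))" if V: "smooth_vfield \<A> V" for V
  proof -
    obtain f where f: "\<And>i. smooth_fun \<A> (f i)" "\<And>i. f i p = V p $ i"
      and eq: "\<And>q. (\<phi> q * \<phi> q) *\<^sub>R V q = (\<Sum>i\<in>UNIV. f i q *\<^sub>R E i q)"
      using ex[OF V] by blast
    have "T (\<lambda>q. (\<phi> q * \<phi> q) *\<^sub>R V q) = (\<phi> p * \<phi> p) *\<^sub>R T V"
      using T V smooth_fun_mult[OF \<phi>(1) \<phi>(1)] by (simp add: tensorial_at_def)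
    then have "T V = T (\<lambda>q. \<Sum>i\<in>UNIV. f i q *\<^sub>R E i q)" using \<phi>(2) by (simp add: eq)
    also have "\<dots> = (\<Sum>i\<in>UNIV. f i p *\<^sub>R T (E i))"
      by (rule conjunct2[OF tensorial_at_sum[OF T finite UNIV_not_empty f(1) E(1)]])
    finally show ?thesis using f by simp
  qed
  then show ?thesis using VW by simp
qed

lemma tensorial_at_extend:
  "tensorial_at p T \<Longrightarrow> smooth_vfield \<A> V \<Longrightarrow> T V = T (extend_vector \<A> p (V p))"
  by (erule tensorial_at_eq) (simp_all add: extend_vector)

text \<open>The chosen extensions need not depend linearly on v, but the extension of v + w and the
  sum of the extensions agree at p, which is all that T sees.\<close>

lemma tensorial_at_linear:
  assumes "tensorial_at p T"
  shows "linear (\<lambda>v. T (extend_vector \<A> p v))"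
proof (rule linearI)
  fix v w k
  let ?e = "extend_vector \<A> p"
  have "T (?e (v + w)) = T (\<lambda>q. ?e v q + ?e w q)"
    by (rule tensorial_at_eq[OF assms]) (simp_all add: extend_vector smooth_vfield_add)
  then show "T (?e (v + w)) = T (?e v) + T (?e w)"
    using assms extend_vector by (simp add: tensorial_at_def)
  have "T (?e (k *\<^sub>R v)) = T (\<lambda>q. k *\<^sub>R ?e v q)"
    by (rule tensorial_at_eq[OF assms])
      (simp_all add: extend_vector smooth_vfield_scaleR[OF smooth_fun_const])
  then show "T (?e (k *\<^sub>R v)) = k *\<^sub>R T (?e v)"
    using assms extend_vector smooth_fun_const by (simp add: tensorial_at_def)
qed

text \<open>Eliminates the chosen extensions: later traces become traces of an explicit map on
  R^n.\<close>

lemma trace_at_eq: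
  assumes "\<And>X. smooth_vfield \<A> X \<Longrightarrow> T X p = L (X p)"
  shows "trace_at \<A> p T = trace (matrix L)"
  by (simp add: trace_at_def assms extend_vector)

lemma vderiv_const [simp]: "vderiv \<A> X (\<lambda>q. k) p = 0"
  by (simp add: vderiv_def comp_def)

end

locale riemannian_manifold = smooth_manifold \<A> for \<A> :: "('a::t2_space, 'n::finite) chart set" +
  fixes g :: "('a, 'n) metric" and nab :: "('a, 'n) connection"
  assumes metric: "riemannian_metric \<A> g" and lc: "levi_civita \<A> g nab"
begin

abbreviation R :: "('a, 'n) tensor_1_3" where
  "R \<equiv> kahler_tensors.Rg \<A> nab"

lemmas R_def = kahler_tensors.Rg_def

lemma bilinear_metric: "bilinear (g p)"
  and metric_sym: "g p v w = g p w v"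
  and metric_pos: "v \<noteq> 0 \<Longrightarrow> g p v v > 0"
  and smooth_metric: "smooth_vfield \<A> X \<Longrightarrow> smooth_vfield \<A> Y \<Longrightarrow> smooth_fun \<A> (\<lambda>q. g q (X q) (Y q))"
  using metric by (simp_all add: riemannian_metric_def)

lemma affine: "affine_connection \<A> nab"
  using lc by (simp add: levi_civita_def)

lemma nab_smooth: "smooth_vfield \<A> X \<Longrightarrow> smooth_vfield \<A> Y \<Longrightarrow> smooth_vfield \<A> (nab X Y)"
  using affine by (simp add: affine_connection_def)

lemma nab_add_left: "smooth_vfield \<A> X \<Longrightarrow> smooth_vfield \<A> X' \<Longrightarrow> smooth_vfield \<A> Y \<Longrightarrow>
    nab (\<lambda>q. X q + X' q) Y = (\<lambda>q. nab X Y q + nab X' Y q)"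
  and nab_add_right: "smooth_vfield \<A> X \<Longrightarrow> smooth_vfield \<A> Y \<Longrightarrow> smooth_vfield \<A> Y' \<Longrightarrow>
    nab X (\<lambda>q. Y q + Y' q) = (\<lambda>q. nab X Y q + nab X Y' q)"
  and nab_scaleR_left: "smooth_fun \<A> f \<Longrightarrow> smooth_vfield \<A> X \<Longrightarrow> smooth_vfield \<A> Y \<Longrightarrow>
    nab (\<lambda>q. f q *\<^sub>R X q) Y = (\<lambda>q. f q *\<^sub>R nab X Y q)"
  and nab_scaleR_right: "smooth_fun \<A> f \<Longrightarrow> smooth_vfield \<A> X \<Longrightarrow> smooth_vfield \<A> Y \<Longrightarrow>
    nab X (\<lambda>q. f q *\<^sub>R Y q) = (\<lambda>q. vderiv \<A> X f q *\<^sub>R Y q + f q *\<^sub>R nab X Y q)"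
  using affine by (simp_all add: affine_connection_def fun_eq_iff)

lemma nab_diff_left: "smooth_vfield \<A> X \<Longrightarrow> smooth_vfield \<A> X' \<Longrightarrow> smooth_vfield \<A> Y \<Longrightarrow>
    nab (\<lambda>q. X q - X' q) Y = (\<lambda>q. nab X Y q - nab X' Y q)"
  using nab_add_left[of X "\<lambda>q. (- 1) *\<^sub>R X' q" Y] nab_scaleR_left[of "\<lambda>q. - 1" X' Y]
  by (simp add: smooth_fun_const smooth_vfield_minus)

lemma nab_diff_right: "smooth_vfield \<A> X \<Longrightarrow> smooth_vfield \<A> Y \<Longrightarrow> smooth_vfield \<A> Y' \<Longrightarrow>
    nab X (\<lambda>q. Y q - Y' q) = (\<lambda>q. nab X Y q - nab X Y' q)"
  using nab_add_right[of X Y "\<lambda>q. (- 1) *\<^sub>R Y' q"] nab_scaleR_right[of "\<lambda>q. - 1" X Y']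
  by (simp add: smooth_fun_const smooth_vfield_minus)

text \<open>Torsion-freeness, read as a rewrite rule that turns brackets into terms accessible to
  \<open>nab_rules\<close>.\<close>

lemma lie_bracket_nab: "smooth_vfield \<A> X \<Longrightarrow> smooth_vfield \<A> Y \<Longrightarrow>
    lie_bracket \<A> X Y = (\<lambda>q. nab X Y q - nab Y X q)"
  using lc by (simp add: levi_civita_def fun_eq_iff)

lemma nab_metric: "smooth_vfield \<A> X \<Longrightarrow> smooth_vfield \<A> Y \<Longrightarrow> smooth_vfield \<A> Z \<Longrightarrow>
    vderiv \<A> X (\<lambda>q. g q (Y q) (Z q)) = (\<lambda>q. g q (nab X Y q) (Z q) + g q (Y q) (nab X Z q))"
  using lc by (simp add: levi_civita_def fun_eq_iff)

lemmas smooth_intros = nab_smooth smooth_vfield_add smooth_vfield_diff smooth_vfield_scaleR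
  smooth_fun_add smooth_fun_diff smooth_fun_mult smooth_fun_vderiv smooth_fun_const smooth_metric

lemmas nab_rules = nab_add_left nab_add_right nab_diff_left nab_diff_right nab_scaleR_left nab_scaleR_right

lemma lie_bracket_smooth: "smooth_vfield \<A> X \<Longrightarrow> smooth_vfield \<A> Y \<Longrightarrow> smooth_vfield \<A> (lie_bracket \<A> X Y)"
  by (simp add: lie_bracket_nab smooth_intros)

section \<open>Tensoriality and symmetries of the Riemannian curvature\<close>

lemma R_antisym:
  "smooth_vfield \<A> X \<Longrightarrow> smooth_vfield \<A> Y \<Longrightarrow> smooth_vfield \<A> Z \<Longrightarrow> R X Y Z p = - R Y X Z p"
  by (simp add: R_def lie_bracket_nab nab_rules smooth_intros)

lemma R_tensorial_1:
  assumes "smooth_vfield \<A> Y" "smooth_vfield \<A> Z"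
  shows "tensorial_at p (\<lambda>X. R X Y Z p)"
  by (rule tensorial_atI)
    (simp_all add: assms R_def lie_bracket_nab nab_rules smooth_intros algebra_simps)

lemma R_tensorial_2:
  assumes "smooth_vfield \<A> X" "smooth_vfield \<A> Z"
  shows "tensorial_at p (\<lambda>Y. R X Y Z p)"
  by (rule tensorial_atI)
    (simp_all add: assms R_def lie_bracket_nab nab_rules smooth_intros algebra_simps)

lemma R_tensorial_3:
  assumes X: "smooth_vfield \<A> X" and Y: "smooth_vfield \<A> Y"
  shows "tensorial_at p (\<lambda>Z. R X Y Z p)"
proof (rule tensorial_atI)
  show "R X Y (\<lambda>q. Z q + Z' q) p = R X Y Z p + R X Y Z' p"
    if "smooth_vfield \<A> Z" "smooth_vfield \<A> Z'" for Z Z'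
    using that by (simp add: assms R_def nab_rules lie_bracket_smooth smooth_intros algebra_simps)
  show "R X Y (\<lambda>q. f q *\<^sub>R Z q) p = f p *\<^sub>R R X Y Z p"
    if f: "smooth_fun \<A> f" and Z: "smooth_vfield \<A> Z" for f Z
  proof -
    \<comment> \<open>The terms with one derivative on f and one on Z cancel; the second derivatives
      of f remain and vanish by the bracket formula.\<close>
    have "R X Y (\<lambda>q. f q *\<^sub>R Z q) p = f p *\<^sub>R R X Y Z p +
      (vderiv \<A> X (vderiv \<A> Y f) p - vderiv \<A> Y (vderiv \<A> X f) p - vderiv \<A> (lie_bracket \<A> X Y) f p) *\<^sub>R Z p"
      by (simp add: assms f Z R_def nab_rules lie_bracket_smooth smooth_intros algebra_simps)
    then show ?thesis by (simp add: vderiv_lie_bracket f X Y)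
  qed
qed

text \<open>Tested on functions, where brackets act as commutators of derivations and all
  third-order terms cancel.\<close>

lemma Jacobi:
  assumes X: "smooth_vfield \<A> X" and Y: "smooth_vfield \<A> Y" and Z: "smooth_vfield \<A> Z"
  shows "lie_bracket \<A> X (lie_bracket \<A> Y Z) p + lie_bracket \<A> Y (lie_bracket \<A> Z X) p +
    lie_bracket \<A> Z (lie_bracket \<A> X Y) p = 0"
proof (rule vector_eq_0_if_vderiv_eq_0)
  fix f assume f: "smooth_fun \<A> f"
  have br: "vderiv \<A> (lie_bracket \<A> X Y) f = (\<lambda>q. vderiv \<A> X (vderiv \<A> Y f) q - vderiv \<A> Y (vderiv \<A> X f) q)"
    if "smooth_vfield \<A> X" "smooth_vfield \<A> Y" for X Y
    using that by (simp add: fun_eq_iff vderiv_lie_bracket f)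
  show "vderiv \<A> (\<lambda>q. lie_bracket \<A> X (lie_bracket \<A> Y Z) q + lie_bracket \<A> Y (lie_bracket \<A> Z X) q +
    lie_bracket \<A> Z (lie_bracket \<A> X Y) q) f p = 0"
    by (simp add: vderiv_linear br vderiv_lie_bracket vderiv_diff f X Y Z lie_bracket_smooth smooth_intros)
qed

text \<open>Torsion-freeness expands each double bracket; the cyclic sum of curvatures is then a
  regrouping of the Jacobi identity.\<close>

lemma first_Bianchi:
  assumes X: "smooth_vfield \<A> X" and Y: "smooth_vfield \<A> Y" and Z: "smooth_vfield \<A> Z"
  shows "R X Y Z p + R Y Z X p + R Z X Y p = 0"
proof -
  have *: "lie_bracket \<A> X (lie_bracket \<A> Y Z) p =
      nab X (nab Y Z) p - nab X (nab Z Y) p - nab (lie_bracket \<A> Y Z) X p"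
    if "smooth_vfield \<A> X" "smooth_vfield \<A> Y" "smooth_vfield \<A> Z" for X Y Z
    using that lie_bracket_nab[of X "lie_bracket \<A> Y Z"] lie_bracket_smooth[of Y Z]
    by (simp add: lie_bracket_nab[of Y Z] nab_rules smooth_intros)
  show ?thesis
    using Jacobi[OF assms, of p] by (simp add: * assms R_def algebra_simps)
qed

text \<open>Differentiate the function g(Z,W) along X and Y: the mixed terms are symmetric in X and
  Y, so the commutator, compared with the derivative along [X,Y], leaves only the curvature
  terms.\<close>

lemma R_skew:
  assumes X: "smooth_vfield \<A> X" and Y: "smooth_vfield \<A> Y" and Z: "smooth_vfield \<A> Z" and W: "smooth_vfield \<A> W"
  shows "g p (R X Y Z p) (W p) + g p (Z p) (R X Y W p) = 0"
proof -
  have vd: "vderiv \<A> X (vderiv \<A> Y (\<lambda>q. g q (Z q) (W q))) p =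
    g p (nab X (nab Y Z) p) (W p) + g p (nab Y Z p) (nab X W p) +
    g p (nab X Z p) (nab Y W p) + g p (Z p) (nab X (nab Y W) p)"
    if "smooth_vfield \<A> X" "smooth_vfield \<A> Y" for X Y
    using that Z W by (simp add: nab_metric vderiv_add smooth_intros)
  have "vderiv \<A> (lie_bracket \<A> X Y) (\<lambda>q. g q (Z q) (W q)) p =
    vderiv \<A> X (vderiv \<A> Y (\<lambda>q. g q (Z q) (W q))) p - vderiv \<A> Y (vderiv \<A> X (\<lambda>q. g q (Z q) (W q))) p"
    by (intro vderiv_lie_bracket smooth_intros assms)
  then show ?thesis
    unfolding vd[OF X Y] vd[OF Y X] nab_metric[OF lie_bracket_smooth[OF X Y] Z W]
    by (simp add: R_def bilinear_lsub[OF bilinear_metric] bilinear_rsub[OF bilinear_metric])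
qed

definition Rp :: "'a \<Rightarrow> real ^ 'n \<Rightarrow> real ^ 'n \<Rightarrow> real ^ 'n \<Rightarrow> real ^ 'n" where
  "Rp p u v w = R (extend_vector \<A> p u) (extend_vector \<A> p v) (extend_vector \<A> p w) p"

text \<open>The arguments are replaced one at a time, since tensoriality in one slot is known only
  with smooth fields fixed in the others.\<close>

lemma R_eq_Rp:
  assumes "smooth_vfield \<A> X" "smooth_vfield \<A> Y" "smooth_vfield \<A> Z"
  shows "R X Y Z p = Rp p (X p) (Y p) (Z p)"
  unfolding Rp_def
  using tensorial_at_extend[OF R_tensorial_1[of Y Z] assms(1), of p]
    tensorial_at_extend[OF R_tensorial_2[of "extend_vector \<A> p (X p)" Z] assms(2), of p]
    tensorial_at_extend[OF R_tensorial_3[of "extend_vector \<A> p (X p)" "extend_vector \<A> p (Y p)"] assms(3), of p]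
  by (simp add: assms extend_vector)

lemma linear_Rp:
  "linear (\<lambda>u. Rp p u v w)" "linear (\<lambda>v. Rp p u v w)" "linear (\<lambda>w. Rp p u v w)"
  unfolding Rp_def
  by (rule tensorial_at_linear[OF R_tensorial_1] tensorial_at_linear[OF R_tensorial_2]
      tensorial_at_linear[OF R_tensorial_3]; rule extend_vector)+

lemma Rp_antisym: "Rp p u v w = - Rp p v u w"
  unfolding Rp_def by (intro R_antisym extend_vector)

lemma Rp_Bianchi: "Rp p u v w + Rp p v w u + Rp p w u v = 0"
  unfolding Rp_def by (intro first_Bianchi extend_vector)

lemma Rp_skew: "g p (Rp p u v w) z + g p w (Rp p u v z) = 0"
  unfolding Rp_def
  using R_skew[OF extend_vector(1)[of p u] extend_vector(1)[of p v] extend_vector(1)[of p w] extend_vector(1)[of p z], of p]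
  by (simp add: extend_vector)

end

section \<open>Traces and curvature in a single tangent space\<close>

abbreviation tr :: "(real ^ 'n \<Rightarrow> real ^ 'n) \<Rightarrow> real" where
  "tr L \<equiv> trace (matrix L)"

lemma tr_eq_sum: "tr L = (\<Sum>i\<in>UNIV. L (axis i 1) $ i)"
  by (simp add: trace_def matrix_def)

lemma tr_add: "tr (\<lambda>v. L v + M v) = tr L + tr M"
  and tr_diff: "tr (\<lambda>v. L v - M v) = tr L - tr M"
  and tr_minus: "tr (\<lambda>v. - L v) = - tr L"
  and tr_scaleR: "tr (\<lambda>v. k *\<^sub>R L v) = k * tr L"
  and tr_ident: "tr (\<lambda>v :: real ^ 'n. v) = real CARD('n)"
  by (simp_all add: tr_eq_sum sum.distrib sum_subtractf sum_negf sum_distrib_left)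

text \<open>Evaluates the terms in which the traced vector enters through a linear form.\<close>

lemma tr_rank_one:
  fixes \<phi> :: "real ^ 'n \<Rightarrow> real"
  assumes "linear \<phi>"
  shows "tr (\<lambda>v. \<phi> v *\<^sub>R w) = \<phi> w"
proof -
  have "\<phi> w = \<phi> (\<Sum>i\<in>UNIV. (w $ i) *\<^sub>R axis i 1)"
    by (simp add: basis_expansion scalar_mult_eq_scaleR[symmetric])
  also have "\<dots> = (\<Sum>i\<in>UNIV. (w $ i) * \<phi> (axis i 1))"
    by (simp add: linear_sum[OF assms] linear_cmul[OF assms])
  finally show ?thesis by (simp add: tr_eq_sum mult.commute)
qed

lemma tr_commute:
  assumes "linear L" "linear M"
  shows "tr (\<lambda>v. L (M v)) = tr (\<lambda>v. M (L v))"
proof -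
  have "tr (L \<circ> M) = tr (M \<circ> L)"
    by (subst (1 2) matrix_compose) (use assms trace_mul_sym in auto)
  then show ?thesis by (simp add: comp_def)
qed

text \<open>With B the matrix of G, adjointness reads L^T B = B M. Definiteness makes B invertible,
  so M is similar to the transpose of L.\<close>

lemma tr_adjoint:
  fixes G :: "real ^ 'n \<Rightarrow> real ^ 'n \<Rightarrow> real"
  assumes G: "bilinear G" "\<And>v. v \<noteq> 0 \<Longrightarrow> G v v \<noteq> 0"
    and LM: "linear L" "linear M" "\<And>v w. G (L v) w = G v (M w)"
  shows "tr L = tr M"
proof -
  define B where "B = (\<chi> i j. G (axis i 1) (axis j 1))"
  have GB: "G v w = v \<bullet> (B *v w)" for v w
  proof -
    have "G v w = G (\<Sum>i\<in>UNIV. (v $ i) *\<^sub>R axis i 1) (\<Sum>j\<in>UNIV. (w $ j) *\<^sub>R axis j 1)"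
      by (simp add: basis_expansion scalar_mult_eq_scaleR[symmetric])
    also have "\<dots> = (\<Sum>i\<in>UNIV. \<Sum>j\<in>UNIV. G ((v $ i) *\<^sub>R axis i 1) ((w $ j) *\<^sub>R axis j 1))"
      by (simp add: bilinear_sum[OF G(1)] sum.cartesian_product)
    also have "\<dots> = v \<bullet> (B *v w)"
      by (simp add: bilinear_lmul[OF G(1)] bilinear_rmul[OF G(1)] inner_vec_def matrix_vector_mult_def
          B_def sum_distrib_left ac_simps)
    finally show ?thesis .
  qed
  have inj: "B *v w = 0 \<Longrightarrow> w = 0" for w
    using G(2)[of w] GB[of w w] by auto
  then obtain C where C: "C ** B = mat 1"
    using matrix_left_invertible_ker[of B] by blast
  then have C': "B ** C = mat 1" by (simp add: matrix_left_right_inverse)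
  have "transpose (matrix L) ** B = B ** matrix M"
  proof (rule matrix_eq[THEN iffD2], rule allI)
    fix w
    have "v \<bullet> ((transpose (matrix L) ** B) *v w) = v \<bullet> ((B ** matrix M) *v w)" for v
    proof -
      have "v \<bullet> ((transpose (matrix L) ** B) *v w) = L v \<bullet> (B *v w)"
        using dot_lmul_matrix[of v "transpose (matrix L)" "B *v w"] LM(1)
        by (simp add: matrix_vector_mul_assoc)
      also have "\<dots> = v \<bullet> (B *v M w)" using LM(3)[of v w] by (simp only: GB)
      finally show ?thesis using LM(2) by (simp add: matrix_vector_mul_assoc[symmetric])
    qed
    then show "(transpose (matrix L) ** B) *v w = (B ** matrix M) *v w"
      by (metis vector_eq_ldot)
  qed
  then have "matrix M = C ** (transpose (matrix L) ** B)"
    by (metis C matrix_mul_assoc matrix_mul_lid)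
  then have "tr M = trace ((transpose (matrix L) ** B) ** C)"
    using trace_mul_sym[of C] by simp
  also have "\<dots> = tr L" by (simp add: C' trace_def transpose_def flip: matrix_mul_assoc)
  finally show ?thesis by simp
qed

section \<open>Algebraic curvature tensors of Kaehler type\<close>

locale kahler_curvature =
  fixes G :: "real ^ 'n \<Rightarrow> real ^ 'n \<Rightarrow> real" and J :: "real ^ 'n \<Rightarrow> real ^ 'n"
    and R :: "real ^ 'n \<Rightarrow> real ^ 'n \<Rightarrow> real ^ 'n \<Rightarrow> real ^ 'n"
  assumes G: "bilinear G" "\<And>v w. G v w = G w v" "\<And>v. v \<noteq> 0 \<Longrightarrow> G v v > 0"
    and J: "linear J" "\<And>v. J (J v) = - v" "\<And>v w. G (J v) (J w) = G v w"
    and R: "\<And>v w. linear (\<lambda>u. R u v w)" "\<And>u w. linear (\<lambda>v. R u v w)" "\<And>u v. linear (\<lambda>w. R u v w)"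
    and antisym: "\<And>u v w. R u v w = - R v u w"
    and Bianchi: "\<And>u v w. R u v w + R v w u + R w u v = 0"
    and skew: "\<And>u v w z. G (R u v w) z + G w (R u v z) = 0"
    and R_J: "\<And>u v w. R u v (J w) = J (R u v w)"
begin

definition ric :: "real ^ 'n \<Rightarrow> real ^ 'n \<Rightarrow> real" where
  "ric v w = tr (\<lambda>u. R u v w)"

lemma G_eqI:
  assumes "\<And>w. G u w = G v w"
  shows "u = v"
proof (rule ccontr)
  assume "u \<noteq> v"
  then have "G (u - v) (u - v) > 0" using G(3) by simp
  then show False using assms by (simp add: bilinear_lsub[OF G(1)])
qed

text \<open>The classical derivation: the Bianchi identities for the four cyclic rotations of
  (u,v,w,z), combined linearly with the two skew-symmetries.\<close>

lemma pair_symmetry: "G (R u v w) z = G (R w z u) v"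
proof -
  have a: "G (R u v w) z = - G (R v u w) z" for u v w z
    using antisym[of u v w] by (simp add: bilinear_lneg[OF G(1)])
  have s: "G (R u v w) z = - G (R u v z) w" for u v w z
    using skew[of u v w z] G(2)[of w] by simp
  have b: "G (R u v w) z + G (R v w u) z + G (R w u v) z = 0" for u v w z
    using Bianchi[of u v w] by (metis bilinear_ladd[OF G(1)] bilinear_lzero[OF G(1)])
  show ?thesis
    using b[of u v w z] b[of v w z u] b[of w z u v] b[of z u v w]
      a[of u v] a[of v w] a[of w u] a[of z u] a[of w z] a[of v z]
      s[of u v w z] s[of v w u z] s[of w u v z] s[of z u v w] s[of w z u v] s[of v z u w]
    by smt
qed

text \<open>Pair symmetry moves u and v to the other pair of slots, where J commutes with R and is
  an isometry.\<close>

lemma R_JJ: "R (J u) (J v) w = R u v w"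
proof (rule G_eqI)
  fix z
  show "G (R (J u) (J v) w) z = G (R u v w) z"
    by (simp add: pair_symmetry[of _ _ w z] R_J J(3))
qed

text \<open>By pair symmetry the G-adjoint of u -> R(u,v)w is u -> R(u,w)v.\<close>

lemma ric_sym: "ric v w = ric w v"
  unfolding ric_def
proof (rule tr_adjoint[OF G(1)])
  show "G (R x v w) y = G x (R y w v)" for x y
    using pair_symmetry[of x v w y] antisym[of w y x] skew[of y w x v]
    by (simp add: bilinear_lneg[OF G(1)])
qed (use G(3) R in \<open>auto simp: less_imp_neq[symmetric]\<close>)

text \<open>J comes out of the last slot, and cyclicity of the trace moves it onto the traced
  argument, where \<open>R_JJ\<close> absorbs both copies.\<close>

lemma ric_JJ: "ric (J v) (J w) = ric v w"
proof -
  have "ric (J v) (J w) = tr (\<lambda>u. J (R u (J v) w))" by (simp add: ric_def R_J)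
  also have "\<dots> = tr (\<lambda>u. R (J u) (J v) w)" by (rule tr_commute[OF J(1) R(1)])
  finally show ?thesis by (simp add: R_JJ ric_def)
qed

lemma ric_linear: "linear (ric v)" "linear (\<lambda>v. ric v w)"
  unfolding ric_def
  by (auto intro!: linearI simp: linear_add[OF R(2)] linear_add[OF R(3)] linear_cmul[OF R(2)]
      linear_cmul[OF R(3)] tr_add tr_scaleR)

lemma ric_J_left: "ric (J v) w = - ric v (J w)"
  using ric_JJ[of v "J w"] by (simp add: J linear_neg[OF ric_linear(1)])

text \<open>So rho is a 2-form, the Ricci form of the Kaehler metric.\<close>

lemma ric_J_antisym: "ric v (J w) = - ric w (J v)"
  using ric_J_left ric_sym by metis

lemma tr_skew:
  assumes "linear L" "\<And>v w. G (L v) w = - G v (L w)"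
  shows "tr L = 0"
proof -
  have "tr L = tr (\<lambda>v. - L v)"
    by (rule tr_adjoint[OF G(1)])
      (use assms G(3) in \<open>auto simp: linear_compose_neg bilinear_rneg[OF G(1)] less_imp_neq[symmetric]\<close>)
  then show ?thesis by (simp add: tr_minus)
qed

lemma tr_J: "tr J = 0"
proof (rule tr_skew[OF J(1)])
  show "G (J v) w = - G v (J w)" for v w
    using J(3)[of v "J w"] by (simp add: J(2) bilinear_rneg[OF G(1)])
qed

lemma tr_R: "tr (R u v) = 0"
  by (rule tr_skew[OF R(3)]) (use skew in \<open>simp add: add_eq_0_iff2\<close>)

end

section \<open>Curvature tensors of a Kaehler manifold with a 1-form\<close>

locale kahler_with_form = riemannian_manifold \<A> g nab + kahler_tensors \<A> A nab \<pi>
  for \<A> :: "('a::t2_space, 'n::finite) chart set" and g A nab \<pi> +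
  assumes dim: "CARD('n) \<ge> 4"
    and A_field: "tensor_field_1_1 \<A> A"
    and A_square: "\<And>p v. A p (A p v) = - v"
    and A_isometry: "\<And>p v w. g p (A p v) (A p w) = g p v w"
    and nab_A: "\<And>X Y p. smooth_vfield \<A> X \<Longrightarrow> smooth_vfield \<A> Y \<Longrightarrow>
      nab X (\<lambda>q. A q (Y q)) p - A p (nab X Y p) = 0"
    and form: "smooth_one_form \<A> \<pi>"
begin

lemma dim_real: "real CARD('n) \<ge> 4"
  using dim by linarith

lemma A_linear: "linear (A p)"
  using A_field by (simp add: tensor_field_1_1_def)

lemma smooth_J: "smooth_vfield \<A> X \<Longrightarrow> smooth_vfield \<A> (J X)"
  using A_field by (simp add: tensor_field_1_1_def)

lemma form_linear: "linear (\<pi> p)"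
  using form by (simp add: smooth_one_form_def)

lemma smooth_form: "smooth_vfield \<A> X \<Longrightarrow> smooth_fun \<A> (\<pi>F X)"
  using form by (simp add: smooth_one_form_def)

lemma R_J:
  assumes "smooth_vfield \<A> X" "smooth_vfield \<A> Y" "smooth_vfield \<A> Z"
  shows "R X Y (J Z) p = A p (R X Y Z p)"
proof -
  have "nab X (J Y) = J (nab X Y)" if "smooth_vfield \<A> X" "smooth_vfield \<A> Y" for X Y
    using nab_A[OF that] by (simp add: fun_eq_iff)
  then show ?thesis
    by (simp add: assms R_def nab_smooth lie_bracket_smooth linear_diff[OF A_linear])
qed

lemma Rp_J: "Rp p u v (A p w) = A p (Rp p u v w)"
  using R_J[OF extend_vector(1)[of p u] extend_vector(1)[of p v] extend_vector(1)[of p w], of p]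
  by (simp add: R_eq_Rp extend_vector smooth_J)

lemma kahler_curvature_at: "kahler_curvature (g p) (A p) (Rp p)"
proof
  show "v \<noteq> 0 \<Longrightarrow> 0 < g p v v" for v by (rule metric_pos)
  show "g p v w = g p w v" for v w by (rule metric_sym)
  show "A p (A p v) = - v" for v by (rule A_square)
  show "g p (A p v) (A p w) = g p v w" for v w by (rule A_isometry)
  show "Rp p u v w = - Rp p v u w" for u v w by (rule Rp_antisym)
  show "Rp p u v w + Rp p v w u + Rp p w u v = 0" for u v w by (rule Rp_Bianchi)
  show "g p (Rp p u v w) z + g p w (Rp p u v z) = 0" for u v w z by (rule Rp_skew)
  show "Rp p u v (A p w) = A p (Rp p u v w)" for u v w by (rule Rp_J)
qed (simp_all add: bilinear_metric linear_add[OF A_linear] linear_cmul[OF A_linear]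
    linear_add[OF linear_Rp(1)] linear_add[OF linear_Rp(2)] linear_add[OF linear_Rp(3)]
    linear_cmul[OF linear_Rp(1)] linear_cmul[OF linear_Rp(2)] linear_cmul[OF linear_Rp(3)])

sublocale pt: kahler_curvature "g p" "A p" "Rp p" for p
  by (rule kahler_curvature_at)

definition Np :: "'a \<Rightarrow> real ^ 'n \<Rightarrow> real ^ 'n \<Rightarrow> real" where
  "Np p u v = nab_form (extend_vector \<A> p u) (extend_vector \<A> p v) p"

lemma nab_form_tensorial_1: "smooth_vfield \<A> Y \<Longrightarrow> tensorial_at p (\<lambda>X. nab_form X Y p)"
  by (rule tensorial_atI)
    (simp_all add: nab_form_def vderiv_linear smooth_form nab_rules linear_add[OF form_linear]
      linear_cmul[OF form_linear] algebra_simps)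

text \<open>The Leibniz terms X(f) pi(Y) from pi(fY) and from nabla_X(fY) cancel.\<close>

lemma nab_form_tensorial_2: "smooth_vfield \<A> X \<Longrightarrow> tensorial_at p (\<lambda>Y. nab_form X Y p)"
  by (rule tensorial_atI)
    (simp_all add: nab_form_def vderiv_add vderiv_mult smooth_form nab_rules linear_add[OF form_linear]
      linear_cmul[OF form_linear] algebra_simps)

lemma nab_form_eq_Np:
  assumes "smooth_vfield \<A> X" "smooth_vfield \<A> Y"
  shows "nab_form X Y p = Np p (X p) (Y p)"
  unfolding Np_def
  using tensorial_at_extend[OF nab_form_tensorial_1[of Y] assms(1), of p]
    tensorial_at_extend[OF nab_form_tensorial_2[of "extend_vector \<A> p (X p)"] assms(2), of p]
  by (simp add: assms extend_vector)

lemma Np_linear: "linear (Np p u)" "linear (\<lambda>u. Np p u v)"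
  unfolding Np_def
  by (rule tensorial_at_linear[OF nab_form_tensorial_2] tensorial_at_linear[OF nab_form_tensorial_1];
      rule extend_vector)+

lemma linear_comp_A: "linear f \<Longrightarrow> linear (\<lambda>v. f (A p v))"
  using linear_compose[OF A_linear] by (simp add: comp_def)

lemma linear_mult_const:
  fixes f :: "real ^ 'n \<Rightarrow> real"
  shows "linear f \<Longrightarrow> linear (\<lambda>v. c * f v)" "linear f \<Longrightarrow> linear (\<lambda>v. f v * c)"
    "linear f \<Longrightarrow> linear (\<lambda>v. f v / c)"
  by (auto intro!: linearI simp: linear_add linear_cmul algebra_simps add_divide_distrib)

lemmas linear_rules = linear_compose_add linear_compose_sub linear_mult_const Np_linear form_linear
  linear_comp_A[OF form_linear] linear_comp_A[OF Np_linear(1)] linear_comp_A[OF Np_linear(2)]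

lemmas neg_rules = linear_neg[OF form_linear] linear_neg[OF Np_linear(1)] linear_neg[OF Np_linear(2)]
  linear_neg[OF pt.ric_linear(1)] linear_neg[OF pt.ric_linear(2)] linear_neg[OF A_linear]

lemmas tr_rules = tr_add tr_diff tr_scaleR tr_ident tr_rank_one pt.tr_J pt.tr_R pt.ric_def[symmetric]

section \<open>Traces of the curvature tensors\<close>

lemma Ric_eq:
  "(\<And>X. smooth_vfield \<A> X \<Longrightarrow> T X Y Z p = L (X p)) \<Longrightarrow> Ric T Y Z p = tr L"
  unfolding ricci_def by (rule trace_at_eq)

lemma Tr3_eq:
  "(\<And>Z. smooth_vfield \<A> Z \<Longrightarrow> T X Y Z p = L (Z p)) \<Longrightarrow> Tr3 T X Y p = tr L"
  unfolding trace3_def by (rule trace_at_eq)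

lemmas D_defs = D0_def D1_def D2_def D3_def nab_form_eq_Np smooth_J R_eq_Rp

context
  fixes Y Z :: "('a, 'n) vfield" and p :: 'a
  assumes YZ: "smooth_vfield \<A> Y" "smooth_vfield \<A> Z"
begin

lemma Ric_Rg: "Ric R Y Z p = pt.ric p (Y p) (Z p)"
  unfolding pt.ric_def by (rule Ric_eq) (simp add: R_eq_Rp YZ)

text \<open>X -> D0(X,Y) AZ has trace D0(AZ,Y), and the multiple of AX has trace 0. In the quadratic
  part the identity contributes n and the rank-one map removes 1, whence n - 1. The other Ricci
  traces follow the same pattern.\<close>

lemma Ric_R0: "Ric R0 Y Z p = pt.ric p (Y p) (Z p)
    - 1/2 * (D0 (J Z) Y p - D0 Y (J Z) p) - 1/2 * D0 (J Y) Z p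
    + 1/4 * \<pi>F Z p * (real CARD('n) - 1) * \<pi>F Y p"
  \<comment> \<open>Unfolding to values at p determines the linear map \<open>L\<close>, whose trace
    is then taken term by term.\<close>
  by (subst Ric_eq, simp only: R0_def D_defs YZ)
    (simp add: YZ D_defs linear_rules tr_rules field_simps)

lemma Ric_R1: "Ric R1 Y Z p = pt.ric p (Y p) (Z p) - D1 (J Z) Y p"
  by (subst Ric_eq, simp only: R1_def D_defs YZ)
    (simp add: YZ D_defs linear_rules tr_rules algebra_simps)

lemma Ric_R2: "Ric R2 Y Z p = pt.ric p (Y p) (Z p) - D2 (J Y) Z p"
  by (subst Ric_eq, simp only: R2_def D_defs YZ)
    (simp add: YZ D_defs linear_rules tr_rules algebra_simps)

lemma Ric_R3: "Ric R3 Y Z p = pt.ric p (Y p) (Z p) - D2 (J Z) Y p"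
  by (subst Ric_eq, simp only: R3_def D_defs YZ)
    (simp add: YZ D_defs linear_rules tr_rules algebra_simps)

lemma Ric_R4: "Ric R4 Y Z p = pt.ric p (Y p) (Z p) - D3 (J Z) Y p
    + (real CARD('n) - 1) * \<pi>F Y p * \<pi>F Z p"
  by (subst Ric_eq, simp only: R4_def D_defs YZ)
    (simp add: YZ D_defs linear_rules tr_rules algebra_simps)

lemma Ric_R5: "Ric R5 Y Z p = pt.ric p (Y p) (Z p)
    - 1/2 * (D2 (J Z) Y p - D3 Y (J Z) p) - 1/2 * D3 (J Y) Z p
    + 1/2 * (real CARD('n) - 1) * \<pi>F Y p * \<pi>F Z p"
  by (subst Ric_eq, simp only: R5_def D_defs YZ)
    (simp add: YZ D_defs linear_rules tr_rules field_simps)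

text \<open>Rp and A are trace-free in the last slot, so only the rank-one map of the D3-term
  survives.\<close>

lemma Tr3_R3: "Tr3 R3 Y Z p = D3 Z (J Y) p"
  by (subst Tr3_eq, simp only: R3_def D_defs YZ)
    (simp add: YZ D_defs linear_rules tr_rules algebra_simps)

text \<open>As for R3; the two quadratic terms have equal traces and cancel.\<close>

lemma Tr3_R4: "Tr3 R4 Y Z p = D3 Z (J Y) p"
  by (subst Tr3_eq, simp only: R4_def D_defs YZ)
    (simp add: YZ D_defs linear_rules tr_rules algebra_simps)

end

context
  fixes X Y Z :: "('a, 'n) vfield" and p :: 'a
  assumes XYZ: "smooth_vfield \<A> X" "smooth_vfield \<A> Y" "smooth_vfield \<A> Z"
begin

text \<open>A normal form with A in the second argument and the fields in the order X, Y, Z.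
  Instantiating the symmetries at these fields keeps the rewriting terminating.\<close>

lemma ric_rules:
  "pt.ric p (Z p) (X p) = pt.ric p (X p) (Z p)" "pt.ric p (Z p) (Y p) = pt.ric p (Y p) (Z p)"
  "pt.ric p (A p u) v = - pt.ric p u (A p v)"
  "pt.ric p (Y p) (A p (X p)) = - pt.ric p (X p) (A p (Y p))"
  "pt.ric p (Z p) (A p (X p)) = - pt.ric p (X p) (A p (Z p))"
  "pt.ric p (Z p) (A p (Y p)) = - pt.ric p (Y p) (A p (Z p))"
  by (rule pt.ric_sym pt.ric_J_left pt.ric_J_antisym)+

lemmas H_rules = XYZ smooth_J smooth_vfield_minus Ric_R0 Ric_R1 Ric_R2 Ric_R3 Ric_R4 Ric_R5 Tr3_R3 Tr3_R4 Ric_Rg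
  D_defs A_square neg_rules ric_rules

lemma P_eq: "P X Y Z p = Rp p (X p) (Y p) (Z p)
   + (1 / (real CARD('n) + 2)) *\<^sub>R (pt.ric p (X p) (Z p) *\<^sub>R Y p - pt.ric p (Y p) (Z p) *\<^sub>R X p)
   + (1 / (real CARD('n) + 2)) *\<^sub>R (pt.ric p (Y p) (A p (Z p)) *\<^sub>R J X p
       - pt.ric p (X p) (A p (Z p)) *\<^sub>R J Y p - (2 * pt.ric p (X p) (A p (Y p))) *\<^sub>R J Z p)"
  using dim_real by (simp add: P_def H_rules vec_eq_iff field_simps)

text \<open>By A^2 = -I the D1-part of Ric R1(Y,AX) is +D1(X,Y), opposite to the D1-term of
  R1.\<close>

lemma H1_eq: "H1 X Y Z p = Rp p (X p) (Y p) (Z p) - pt.ric p (X p) (A p (Y p)) *\<^sub>R J Z p"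
  by (simp add: H1_def R1_def H_rules vec_eq_iff algebra_simps)

lemma H2_eq: "H2 X Y Z p = Rp p (X p) (Y p) (Z p) + pt.ric p (Y p) (A p (Z p)) *\<^sub>R J X p
    - pt.ric p (X p) (A p (Z p)) *\<^sub>R J Y p"
  by (simp add: H2_def R2_def H_rules vec_eq_iff algebra_simps)

text \<open>The traces with a single A remove the D3-terms of R4. Ric R4(Y,Z) - 'R4(AY,AZ) is
  Ric(Y,Z) + (n-1) pi(Y) pi(Z), so division by n-1 also removes the quadratic term.\<close>

lemma H4_eq: "H4 X Y Z p = Rp p (X p) (Y p) (Z p)
    + (1 / (real CARD('n) - 1)) *\<^sub>R (pt.ric p (X p) (Z p) *\<^sub>R Y p - pt.ric p (Y p) (Z p) *\<^sub>R X p)"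
  proof -
  \<comment> \<open>With n = k + 1 the denominator n - 1 becomes a positive atom that field
    arithmetic can cancel.\<close>
  obtain k where k: "real CARD('n) = k + 1" "k > 0"
    using dim_real by (intro that[of "real CARD('n) - 1"]) auto
  then show ?thesis
    by (simp add: H4_def R4_def H_rules vec_eq_iff field_simps)
qed

text \<open>Ric R5(Y,Z) minus half of Ric R1(Y,Z) and half of 'R3(AZ,AY) is Ric(Y,Z)/2 + (n-1)/2
  pi(Y) pi(Z); the loss of half of Ric explains the coefficient 1/(2(n-1)).\<close>

lemma H5_eq: "H5 X Y Z p = Rp p (X p) (Y p) (Z p)
    + (1 / (2 * (real CARD('n) - 1))) *\<^sub>R (pt.ric p (X p) (Y p) *\<^sub>R Z p - pt.ric p (Y p) (Z p) *\<^sub>R X p)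
    + (1/2) *\<^sub>R (pt.ric p (Y p) (A p (Z p)) *\<^sub>R J X p - pt.ric p (X p) (A p (Y p)) *\<^sub>R J Z p)"
  proof -
  obtain k where k: "real CARD('n) = k + 1" "k > 0"
    using dim_real by (intro that[of "real CARD('n) - 1"]) auto
  then show ?thesis
    by (simp add: H5_def R5_def H_rules vec_eq_iff field_simps)
qed

text \<open>D0 is the mean of D2 and D3, which Ric R3 and 'R3 supply separately; hence their equal
  weights 1/4. Of the Ricci terms Ric(Y,Z)/4 + (n-1)/4 pi(Y) pi(Z) remains.\<close>

lemma H0_eq: "H0 X Y Z p = Rp p (X p) (Y p) (Z p)
    + (1 / (4 * (real CARD('n) - 1))) *\<^sub>R (pt.ric p (X p) (Z p) *\<^sub>R Y p - pt.ric p (Y p) (Z p) *\<^sub>R X p)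
    + (1/4) *\<^sub>R (pt.ric p (Y p) (A p (Z p)) *\<^sub>R J X p
       - pt.ric p (X p) (A p (Z p)) *\<^sub>R J Y p - (2 * pt.ric p (X p) (A p (Y p))) *\<^sub>R J Z p)"
  proof -
  obtain k where k: "real CARD('n) = k + 1" "k > 0"
    using dim_real by (intro that[of "real CARD('n) - 1"]) auto
  then show ?thesis
    by (simp add: H0_def R0_def H_rules vec_eq_iff field_simps)
qed

end

end

section \<open>Comparison of coefficients\<close>

theorem corollary5p1:
  fixes \<A> :: "('a::{t2_space, second_countable_topology}, 'n::finite) chart set"
    and g :: "('a, 'n) metric"
    and A :: "('a, 'n) endo_field"
    and nab nab1 :: "('a, 'n) connection"
    and \<pi> :: "('a, 'n) one_form"
    and X Y Z :: "('a, 'n) vfield"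
    and p :: 'a
    and n :: real
  assumes "kahler_manifold \<A> g A nab"
    and "n = real CARD('n)"
    and "qsm_A_connection \<A> A nab \<pi> nab1"
    and "smooth_vfield \<A> X" and "smooth_vfield \<A> Y" and "smooth_vfield \<A> Z"
  shows
    "kahler_tensors.P \<A> A nab X Y Z p =
       (4 / (n + 2)) *\<^sub>R kahler_tensors.H0 \<A> A nab \<pi> X Y Z p
       + ((n - 2) / (n + 2)) *\<^sub>R kahler_tensors.H4 \<A> A nab \<pi> X Y Z p
     \<and>
     kahler_tensors.P \<A> A nab X Y Z p =
       (4 * (n - 1) / (n + 2)) *\<^sub>R kahler_tensors.H0 \<A> A nab \<pi> X Y Z p
       - (2 * (n - 2) / (n + 2)) *\<^sub>R kahler_tensors.H1 \<A> A nab \<pi> X Y Z p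
       - ((n - 2) / (n + 2)) *\<^sub>R kahler_tensors.H2 \<A> A nab \<pi> X Y Z p
     \<and>
     kahler_tensors.P \<A> A nab X Y Z p =
       (4 / (n + 2)) *\<^sub>R kahler_tensors.H0 \<A> A nab \<pi> X Y Z p
       + ((n - 2) / (n + 2)) *\<^sub>R
           (2 *\<^sub>R kahler_tensors.H5 \<A> A nab \<pi> X Z Y p
            - kahler_tensors.H1 \<A> A nab \<pi> X Z Y p
            + kahler_tensors.H1 \<A> A nab \<pi> Z Y X p)"
proof -
  interpret kahler_with_form \<A> g A nab \<pi>
    using assms(1,3) by unfold_locales (simp_all add: kahler_manifold_def qsm_A_connection_def)
  \<comment> \<open>P, H0, H1, H2 and H4 at (X,Y,Z) are combinations of these five vectors with
    coefficients rational in n.\<close>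
  define R' S E F K where "R' = Rp p (X p) (Y p) (Z p)"
    and "S = pt.ric p (X p) (Z p) *\<^sub>R Y p - pt.ric p (Y p) (Z p) *\<^sub>R X p"
    and "E = pt.ric p (Y p) (A p (Z p)) *\<^sub>R J X p"
    and "F = pt.ric p (X p) (A p (Z p)) *\<^sub>R J Y p"
    and "K = pt.ric p (X p) (A p (Y p)) *\<^sub>R J Z p"
  note defs = R'_def S_def E_def F_def K_def
  have "R' = - (Rp p (Y p) (Z p) (X p) + Rp p (Z p) (X p) (Y p))"
    using Rp_Bianchi[of p "X p" "Y p" "Z p"] by (simp only: R'_def eq_neg_iff_add_eq_0 add.assoc)
  then have Bianchi: "R' = Rp p (X p) (Z p) (Y p) + Rp p (Z p) (Y p) (X p)"
    by (simp add: Rp_antisym[of p "X p" "Z p" "Y p"] Rp_antisym[of p "Z p" "Y p" "X p"])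
  have sym: "pt.ric p (Z p) (Y p) = pt.ric p (Y p) (Z p)"
      "pt.ric p (Z p) (A p (Y p)) = - pt.ric p (Y p) (A p (Z p))"
    by (rule pt.ric_sym pt.ric_J_antisym)+
  have n: "n \<ge> 4" using dim_real assms(2) by simp
  have P: "P X Y Z p = R' + (1 / (n + 2)) *\<^sub>R S + (1 / (n + 2)) *\<^sub>R (E - F - 2 *\<^sub>R K)"
    and H0: "H0 X Y Z p = R' + (1 / (4 * (n - 1))) *\<^sub>R S + (1/4) *\<^sub>R (E - F - 2 *\<^sub>R K)"
    and H1: "H1 X Y Z p = R' - K"
    and H2: "H2 X Y Z p = R' + E - F"
    and H4: "H4 X Y Z p = R' + (1 / (n - 1)) *\<^sub>R S"
    using P_eq[OF assms(4-6), of p] H0_eq[OF assms(4-6), of p] H1_eq[OF assms(4-6), of p]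
      H2_eq[OF assms(4-6), of p] H4_eq[OF assms(4-6), of p] assms(2)
    by (simp_all add: defs)
  \<comment> \<open>The rho-terms of the two H1's cancel those of 2 H5, so the bracket is H4(X,Y)Z
    and the third relation reduces to the first.\<close>
  have H5: "2 *\<^sub>R H5 X Z Y p - H1 X Z Y p + H1 Z Y X p = R' + (1 / (n - 1)) *\<^sub>R S"
  proof -
    define b where "b = 1 / (n - 1)"
    have "1 / (2 * (real CARD('n) - 1)) = b / 2" using assms(2) by (simp add: b_def)
    then show ?thesis
      unfolding H5_eq[OF assms(4,6,5)] H1_eq[OF assms(4,6,5)] H1_eq[OF assms(6,5,4)] Bianchi b_def[symmetric]
      by (simp only: sym S_def) (simp add: vec_eq_iff field_simps)
  qed
  \<comment> \<open>In terms of v the coefficients are affine: 4/(n+2) = 1 - v and 4(n-1)/(n+2) = 1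
    + 3v. The only relation tying b to v is (1 + 3v) b = 1 - v.\<close>
  define v b where "v = (n - 2) / (n + 2)" and "b = 1 / (n - 1)"
  have coeffs: "1 / (n + 2) = (1 - v) / 4" "4 / (n + 2) = 1 - v" "4 * (n - 1) / (n + 2) = 1 + 3 * v"
      "2 * (n - 2) / (n + 2) = 2 * v" "1 / (4 * (n - 1)) = b / 4"
    using n by (simp_all add: v_def b_def field_simps)
  have "4 * (n - 1) / (n + 2) * b = 4 / (n + 2)"
    using n by (simp add: b_def divide_simps)
  then have b: "(1 + 3 * v) * b = 1 - v"
    by (simp only: coeffs)
  \<comment> \<open>The relation is multiplied out into the monomials that occur in the goals, which
    it then settles linearly.\<close>
  have "(b + 3 * (v * b)) * S $ i = (1 - v) * S $ i" for i
    unfolding b[symmetric] by (simp add: algebra_simps)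
  then have bS: "b * S $ i + 3 * (v * (b * S $ i)) = S $ i - v * S $ i" for i
    by (simp add: algebra_simps)
  show ?thesis
    unfolding P H0 H1 H2 H4 H5 coeffs v_def[symmetric] b_def[symmetric] vec_eq_iff
  proof (intro conjI allI, goal_cases)
    case (1 i)
    show ?case using bS[of i] by (simp add: field_simps)
  next
    case (2 i)
    show ?case using bS[of i] by (simp add: field_simps)
  next
    case (3 i)
    show ?case using bS[of i] by (simp add: field_simps)
  qed
qed

end
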